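(* The class of $(P_7,C_4+K_2)$-free bipartite graphs is factorial.
   Context: Graphs are finite, simple and undirected. A graph is $(H_1,H_2)$-free if it contains no induced subgraph isomorphic to $H_1$ or $H_2$. $P_7$ is the chordless path with 7 vertices, and $C_4+K_2$ is the disjoint union of the chordless cycle $C_4$ and $K_2$. A hereditary class (one closed under taking induced subgraphs) is factorial if the number of labelled graphs in it with vertex set $\{1,\ldots,n\}$ is $2^{\Theta(n\log n)}$. *)

theory Defs
  imports Complex_Main "HOL-Library.Landau_Symbols"
begin

text \<open>A graph is a pair of a vertex set and a set of edges, an edge being the two-element
  set of its endpoints. \<open>simple_graph\<close> singles out the finite simple undirected graphs.\<close>

type_synonym 'a graph = "'a set \<times> 'a set set"

abbreviation verts :: "'a graph \<Rightarrow> 'a set" where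
  "verts G \<equiv> fst G"

abbreviation edges :: "'a graph \<Rightarrow> 'a set set" where
  "edges G \<equiv> snd G"

definition simple_graph :: "'a graph \<Rightarrow> bool" where
  "simple_graph G \<longleftrightarrow> finite (verts G) \<and> (\<forall>e\<in>edges G. e \<subseteq> verts G \<and> card e = 2)"

definition induced_subgraph :: "'a graph \<Rightarrow> 'a set \<Rightarrow> 'a graph" where
  "induced_subgraph G S = (S, {e \<in> edges G. e \<subseteq> S})"

definition isomorphic :: "'a graph \<Rightarrow> 'b graph \<Rightarrow> bool" where
  "isomorphic G H \<longleftrightarrow>
     (\<exists>f. bij_betw f (verts G) (verts H) \<and>
          (\<forall>u\<in>verts G. \<forall>v\<in>verts G. {u, v} \<in> edges G \<longleftrightarrow> {f u, f v} \<in> edges H))"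

definition induced_free :: "'b graph \<Rightarrow> 'a graph \<Rightarrow> bool" where
  "induced_free H G \<longleftrightarrow> \<not> (\<exists>S. S \<subseteq> verts G \<and> isomorphic (induced_subgraph G S) H)"

definition bipartite :: "'a graph \<Rightarrow> bool" where
  "bipartite G \<longleftrightarrow>
     (\<exists>A B. A \<union> B = verts G \<and> A \<inter> B = {} \<and>
            (\<forall>e\<in>edges G. \<exists>a\<in>A. \<exists>b\<in>B. e = {a, b}))"

text \<open>\<open>path_graph k\<close> is the path with \<open>k\<close> vertices (not \<open>k\<close> edges);
  \<open>cycle_graph k\<close> is meaningful for \<open>k \<ge> 3\<close>.\<close>

definition path_graph :: "nat \<Rightarrow> nat graph" where
  "path_graph k = ({..<k}, {{i, Suc i} | i. Suc i < k})"

definition cycle_graph :: "nat \<Rightarrow> nat graph" where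
  "cycle_graph k = ({..<k}, {{i, Suc i mod k} | i. i < k})"

definition complete_graph :: "nat \<Rightarrow> nat graph" where
  "complete_graph k = ({..<k}, {{i, j} | i j. i < k \<and> j < k \<and> i \<noteq> j})"

definition disjoint_union :: "'a graph \<Rightarrow> 'b graph \<Rightarrow> ('a + 'b) graph" where
  "disjoint_union G H =
     (verts G <+> verts H, (\<lambda>e. Inl ` e) ` edges G \<union> (\<lambda>e. Inr ` e) ` edges H)"

text \<open>Classes of graphs are represented by their members with vertices in \<^typ>\<open>nat\<close>.
  As usual for graph classes, they are required to be closed under isomorphism.\<close>

definition graph_class :: "nat graph set \<Rightarrow> bool" where
  "graph_class X \<longleftrightarrow>
     (\<forall>G\<in>X. simple_graph G) \<and>
     (\<forall>G\<in>X. \<forall>H. simple_graph H \<and> isomorphic G H \<longrightarrow> H \<in> X)"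

definition hereditary :: "nat graph set \<Rightarrow> bool" where
  "hereditary X \<longleftrightarrow>
     graph_class X \<and> (\<forall>G\<in>X. \<forall>S. S \<subseteq> verts G \<longrightarrow> induced_subgraph G S \<in> X)"

definition labelled_count :: "nat graph set \<Rightarrow> nat \<Rightarrow> nat" where
  "labelled_count X n = card {G \<in> X. verts G = {1..n}}"

definition factorial_class :: "nat graph set \<Rightarrow> bool" where
  "factorial_class X \<longleftrightarrow>
     hereditary X \<and>
     (\<exists>f :: nat \<Rightarrow> real. f \<in> \<Theta>(\<lambda>n. real n * log 2 (real n)) \<and>
        (\<forall>\<^sub>F n in sequentially. real (labelled_count X n) = 2 powr f n))"

end

theory Submission
  imports Defs "HOL-Library.FuncSet"
begin

text \<open>The lower bound on the speed is given by star forests, which contain neither \<open>P\<^sub>7\<close> nor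
  \<open>C\<^sub>4\<close>: choosing a centre among \<open>n div 2\<close> for each of the other vertices gives \<open>2\<close> to the power
  \<open>\<Omega>(n log n)\<close> of them.

  For the upper bound it is enough that every nonempty graph \<open>G\<close> of the class has a vertex whose
  neighbourhood can be described by \<open>O(log n)\<close> bits once the rest of \<open>G\<close> is known: deleting such
  vertices one by one then encodes \<open>G\<close> by \<open>O(n log n)\<close> bits (\<open>card_free_relations\<close>). The
  descriptions used (\<open>removable_def\<close>) say that, up to a bounded number of exceptions, the
  neighbourhood is empty, or the common neighbourhood of two other vertices, or consists of the
  vertices that have at least \<open>s\<close> neighbours in such a common neighbourhood.

  Let \<open>A\<close> and \<open>B\<close> be the parts, and take \<open>y\<close> and \<open>z\<close> in \<open>B\<close> with a largest set \<open>X\<close> of common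
  neighbours. Vertices of \<open>B\<close> that miss only a
  bounded number of elements of \<open>X\<close> have, by maximality, few neighbours among the remaining neighbours of \<open>y\<close>
  and \<open>z\<close>, and bounded codegrees elsewhere. The vertices outside the neighbourhoods of \<open>y\<close> and \<open>z\<close>
  can only be adjacent to these, as \<open>C\<^sub>4 + K\<^sub>2\<close> is excluded. In a \<open>P\<^sub>7\<close>-free bipartite graph
  with bounded codegrees on one side some vertex has bounded degree (\<open>low_degree_vertex\<close>); this
  provides a vertex as required if there are any vertices of these two kinds besides \<open>y\<close> and \<open>z\<close>.

  This leaves \<open>A = X \<union> C1 \<union> C2\<close>, where \<open>C1\<close> and \<open>C2\<close> are the neighbours private to \<open>y\<close> and to
  \<open>z\<close>, and apart from \<open>y\<close> and \<open>z\<close> only \<open>far\<close> vertices in \<open>B\<close>, which miss many elements of \<open>X\<close>. If \<open>a\<close> in \<open>C1\<close> is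
  adjacent to the far vertex \<open>b\<close> but not to \<open>b'\<close>, then excluding \<open>C\<^sub>4 + K\<^sub>2\<close> forces the
  neighbours of \<open>b'\<close> in \<open>X\<close> to be neighbours of \<open>b\<close>, up to one. Thus the neighbourhood of \<open>a\<close> is
  roughly an upper set in the order of the far vertices by their number of neighbours in \<open>X\<close>, and \<open>a\<close> has a
  description of the third kind unless many far vertices of almost equal neighbourhood in \<open>X\<close> are
  separated by \<open>a\<close> (\<open>wild_cluster\<close>). If this happens for all of \<open>C1 \<union> C2\<close>, then excluding
  \<open>P\<^sub>7\<close> produces two vertices with almost the same neighbourhood (\<open>twins_in_cluster\<close>), and
  one of them can be deleted. If \<open>C1 \<union> C2\<close> is empty, then \<open>y\<close> and \<open>z\<close> are such a pair.\<close>

section \<open>Bipartite graphs as relations\<close>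

text \<open>A bipartite graph with parts \<open>A\<close> and \<open>B\<close> is handled as a relation \<open>R \<subseteq> A \<times> B\<close>.
  \<open>has_P7\<close> is a path \<open>b1 a1 b2 a2 b3 a3 b4\<close> with both ends in the second part, so the paths
  with both ends in the first part are those of \<open>R\<inverse>\<close>. The seven vertices are distinct because
  no two of them on the same side have the same neighbours on the path. Likewise in
  \<open>has_C4_K2\<close> only the two vertices of the cycle on either side have to be told apart. All these
  vertices have a neighbour, so the parts need not be mentioned.\<close>

definition has_P7 :: "('a \<times> 'b) set \<Rightarrow> bool" where
  "has_P7 R \<longleftrightarrow> (\<exists>a1 a2 a3 b1 b2 b3 b4.
     (a1, b1) \<in> R \<and> (a1, b2) \<in> R \<and> (a2, b2) \<in> R \<and> (a2, b3) \<in> R \<and> (a3, b3) \<in> R \<and> (a3, b4) \<in> R \<and>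
     (a1, b3) \<notin> R \<and> (a1, b4) \<notin> R \<and> (a2, b1) \<notin> R \<and> (a2, b4) \<notin> R \<and> (a3, b1) \<notin> R \<and> (a3, b2) \<notin> R)"

definition has_C4_K2 :: "('a \<times> 'b) set \<Rightarrow> bool" where
  "has_C4_K2 R \<longleftrightarrow> (\<exists>a1 a2 a3 b1 b2 b3. a1 \<noteq> a2 \<and> b1 \<noteq> b2 \<and>
     (a1, b1) \<in> R \<and> (a1, b2) \<in> R \<and> (a2, b1) \<in> R \<and> (a2, b2) \<in> R \<and> (a3, b3) \<in> R \<and>
     (a1, b3) \<notin> R \<and> (a2, b3) \<notin> R \<and> (a3, b1) \<notin> R \<and> (a3, b2) \<notin> R)"

definition nbrs :: "('a \<times> 'b) set \<Rightarrow> 'b \<Rightarrow> 'a set" where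
  "nbrs R b = {a. (a, b) \<in> R}"

lemma mem_nbrs [simp]: "a \<in> nbrs R b \<longleftrightarrow> (a, b) \<in> R"
  by (simp add: nbrs_def)

lemma has_P7_restrict:
  assumes "has_P7 (R \<inter> S \<times> T)" shows "has_P7 R"
proof -
  obtain a1 a2 a3 b1 b2 b3 b4 where h:
    "(a1, b1) \<in> R \<inter> S \<times> T" "(a1, b2) \<in> R \<inter> S \<times> T" "(a2, b2) \<in> R \<inter> S \<times> T"
    "(a2, b3) \<in> R \<inter> S \<times> T" "(a3, b3) \<in> R \<inter> S \<times> T" "(a3, b4) \<in> R \<inter> S \<times> T"
    "(a1, b3) \<notin> R \<inter> S \<times> T" "(a1, b4) \<notin> R \<inter> S \<times> T" "(a2, b1) \<notin> R \<inter> S \<times> T"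
    "(a2, b4) \<notin> R \<inter> S \<times> T" "(a3, b1) \<notin> R \<inter> S \<times> T" "(a3, b2) \<notin> R \<inter> S \<times> T"
    using assms unfolding has_P7_def by blast
  show ?thesis unfolding has_P7_def
    by (rule exI[of _ a1], rule exI[of _ a2], rule exI[of _ a3], rule exI[of _ b1], rule exI[of _ b2],
        rule exI[of _ b3], rule exI[of _ b4]) (use h in simp)
qed

lemma has_C4_K2_restrict:
  assumes "has_C4_K2 (R \<inter> S \<times> T)" shows "has_C4_K2 R"
proof -
  obtain a1 a2 a3 b1 b2 b3 where h: "a1 \<noteq> a2" "b1 \<noteq> b2"
    "(a1, b1) \<in> R \<inter> S \<times> T" "(a1, b2) \<in> R \<inter> S \<times> T" "(a2, b1) \<in> R \<inter> S \<times> T"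
    "(a2, b2) \<in> R \<inter> S \<times> T" "(a3, b3) \<in> R \<inter> S \<times> T"
    "(a1, b3) \<notin> R \<inter> S \<times> T" "(a2, b3) \<notin> R \<inter> S \<times> T" "(a3, b1) \<notin> R \<inter> S \<times> T" "(a3, b2) \<notin> R \<inter> S \<times> T"
    using assms unfolding has_C4_K2_def by blast
  show ?thesis unfolding has_C4_K2_def
    by (rule exI[of _ a1], rule exI[of _ a2], rule exI[of _ a3], rule exI[of _ b1], rule exI[of _ b2],
        rule exI[of _ b3]) (use h in simp)
qed

lemma two_elements:
  assumes "2 \<le> card S" obtains x y where "x \<in> S" "y \<in> S" "x \<noteq> y"
  using assms by (metis card_le_Suc_iff insertCI numeral_2_eq_2 Suc_le_eq card_gt_0_iff equals0I less_nat_zero_code card.empty)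

lemma third_element:
  assumes "3 \<le> card S" obtains x where "x \<in> S" "x \<noteq> u" "x \<noteq> v"
proof -
  have "\<not> S \<subseteq> {u, v}"
  proof
    assume "S \<subseteq> {u, v}"
    then have "card S \<le> card {u, v}" by (intro card_mono) auto
    also have "\<dots> \<le> 2" by (simp add: card_insert_if)
    finally show False using assms by simp
  qed
  then show thesis using that by blast
qed

section \<open>A vertex of low degree when codegrees are bounded\<close>

text \<open>If all degrees were larger, an induced \<open>P\<^sub>7\<close> could be grown from its middle vertex \<open>v\<close>.
  Two neighbours \<open>a1\<close>, \<open>a2\<close> of \<open>v\<close> have incomparable neighbourhoods, since otherwise the
  smallest of these neighbourhoods would contain a second vertex, adjacent to all neighbours
  of \<open>v\<close>. This gives \<open>b1 a1 v a2 b2\<close>, and both ends extend, because less than all of the more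
  than \<open>2 * k\<close> neighbours of \<open>b1\<close> are lost to the codegrees with \<open>v\<close> and \<open>b2\<close>.\<close>

lemma low_degree_vertex:
  assumes fin: "finite U" "finite W" and ne: "U \<noteq> {} \<or> W \<noteq> {}" and sub: "R \<subseteq> U \<times> W"
    and P7: "\<not> has_P7 (R\<inverse>)" and k: "1 \<le> k"
    and codeg: "\<And>b b'. b \<in> W \<Longrightarrow> b' \<in> W \<Longrightarrow> b \<noteq> b' \<Longrightarrow> card (nbrs R b \<inter> nbrs R b') \<le> k"
  shows "(\<exists>a\<in>U. card (R `` {a}) \<le> 1) \<or> (\<exists>b\<in>W. card (nbrs R b) \<le> 2 * k)"
proof (rule ccontr)
  assume "\<not> ?thesis"
  then have degU: "\<And>a. a \<in> U \<Longrightarrow> 2 \<le> card (R `` {a})"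
    and degW: "\<And>b. b \<in> W \<Longrightarrow> 2 * k < card (nbrs R b)"
    by (auto simp: not_le Suc_le_eq numeral_2_eq_2)
  have finN: "finite (nbrs R b)" for b
    by (rule finite_subset[OF _ fin(1)]) (use sub in auto)
  have finI: "finite (R `` {a})" for a
    by (rule finite_subset[OF _ fin(2)]) (use sub in auto)
  have NU: "nbrs R b \<subseteq> U" for b using sub by auto
  have IW: "R `` {a} \<subseteq> W" for a using sub by auto
  obtain v where v: "v \<in> W"
  proof (cases "W = {}")
    case True
    then obtain a where "a \<in> U" using ne by auto
    then have "2 \<le> card (R `` {a})" by (rule degU)
    moreover have "R `` {a} = {}" using IW[of a] True by auto
    ultimately show thesis by simp
  qed (use that in auto)
  obtain a1 a2 where a: "(a1, v) \<in> R" "(a2, v) \<in> R"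
    "\<not> R `` {a1} \<subseteq> R `` {a2}" "\<not> R `` {a2} \<subseteq> R `` {a1}"
  proof (rule ccontr)
    assume "\<not> thesis"
    with that have chain: "\<And>a a'. (a, v) \<in> R \<Longrightarrow> (a', v) \<in> R \<Longrightarrow> R `` {a} \<subseteq> R `` {a'} \<or> R `` {a'} \<subseteq> R `` {a}"
      by meson
    have "nbrs R v \<noteq> {}" using degW[OF v] by auto
    then obtain a0 where a0: "a0 \<in> nbrs R v" and
       least: "\<And>a. a \<in> nbrs R v \<Longrightarrow> card (R `` {a0}) \<le> card (R `` {a})"
      using arg_min_if_finite[OF finN, of v "\<lambda>a. card (R `` {a})"] by (metis not_le)
    \<comment> \<open>in a chain, the member of least size is contained in all others\<close>
    have below: "R `` {a0} \<subseteq> R `` {a}" if "a \<in> nbrs R v" for a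
    proof -
      have "R `` {a} \<subseteq> R `` {a0} \<Longrightarrow> R `` {a} = R `` {a0}"
        using card_seteq[OF finI] least[OF that] by blast
      then show ?thesis using chain[of a a0] that a0 by auto
    qed
    have "2 \<le> card (R `` {a0})" using degU a0 NU by blast
    then obtain v' where v': "v' \<in> R `` {a0}" "v' \<noteq> v"
      by (metis two_elements)
    have "nbrs R v \<subseteq> nbrs R v' \<inter> nbrs R v"
    proof
      fix x assume "x \<in> nbrs R v"
      then show "x \<in> nbrs R v' \<inter> nbrs R v" using below[of x] v' by auto
    qed
    then have "card (nbrs R v) \<le> card (nbrs R v' \<inter> nbrs R v)" by (intro card_mono) (auto simp: finN)
    also have "\<dots> \<le> k" using codeg v v' IW by blast
    finally show False using degW[OF v] by simp
  qed
  then obtain b1 b2 where b: "(a1, b1) \<in> R" "(a2, b1) \<notin> R" "(a2, b2) \<in> R" "(a1, b2) \<notin> R"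
    by auto
  have *: "\<exists>c. (c, b) \<in> R \<and> (c, v) \<notin> R \<and> (c, b') \<notin> R" if "b \<in> W" "b' \<in> W" "b \<noteq> v" "b' \<noteq> b" for b b'
  proof (rule ccontr)
    assume "\<not> ?thesis"
    then have "nbrs R b \<subseteq> (nbrs R b \<inter> nbrs R v) \<union> (nbrs R b \<inter> nbrs R b')" by auto
    then have "card (nbrs R b) \<le> card ((nbrs R b \<inter> nbrs R v) \<union> (nbrs R b \<inter> nbrs R b'))"
      by (intro card_mono) (auto simp: finN)
    also have "\<dots> \<le> k + k"
      by (rule order_trans[OF card_Un_le add_mono]) (use codeg that v in auto)
    finally show False using degW[OF that(1)] by simp
  qed
  have bW: "b1 \<in> W" "b2 \<in> W" using b sub by auto
  obtain c1 where c1: "(c1, b1) \<in> R" "(c1, v) \<notin> R" "(c1, b2) \<notin> R"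
    using *[of b1 b2] b a bW by metis
  obtain c2 where c2: "(c2, b2) \<in> R" "(c2, v) \<notin> R" "(c2, b1) \<notin> R"
    using *[of b2 b1] b a bW by metis
  have "has_P7 (R\<inverse>)" unfolding has_P7_def
    by (rule exI[of _ b1], rule exI[of _ v], rule exI[of _ b2], rule exI[of _ c1], rule exI[of _ a1],
        rule exI[of _ a2], rule exI[of _ c2]) (use a b c1 c2 in simp)
  then show False using P7 by simp
qed

section \<open>Removable vertices\<close>

locale P7_C4_K2_free =
  fixes A :: "'a set" and B :: "'b set" and R :: "('a \<times> 'b) set"
  assumes finA: "finite A" and finB: "finite B" and sub: "R \<subseteq> A \<times> B"
    and P7: "\<not> has_P7 R" and P7': "\<not> has_P7 (R\<inverse>)" and C4_K2: "\<not> has_C4_K2 R"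
begin

lemma finN [simp]: "finite (nbrs R b)"
  by (rule finite_subset[OF _ finA]) (use sub in auto)

lemma nbrs_subset: "nbrs R b \<subseteq> A"
  using sub by auto

lemma no_P7:
  assumes "(a1, b1) \<in> R" "(a1, b2) \<in> R" "(a2, b2) \<in> R" "(a2, b3) \<in> R" "(a3, b3) \<in> R" "(a3, b4) \<in> R"
     "(a1, b3) \<notin> R" "(a1, b4) \<notin> R" "(a2, b1) \<notin> R" "(a2, b4) \<notin> R" "(a3, b1) \<notin> R" "(a3, b2) \<notin> R"
   shows False
  using P7 assms unfolding has_P7_def by blast

lemma no_C4_K2:
  assumes "a1 \<noteq> a2" "b1 \<noteq> b2"
     "(a1, b1) \<in> R" "(a1, b2) \<in> R" "(a2, b1) \<in> R" "(a2, b2) \<in> R" "(a3, b3) \<in> R"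
     "(a1, b3) \<notin> R" "(a2, b3) \<notin> R" "(a3, b1) \<notin> R" "(a3, b2) \<notin> R"
   shows False
  using C4_K2 assms unfolding has_C4_K2_def by blast

end

text \<open>The candidates for an approximate description of the neighbourhood of a deleted vertex
  from what remains. \<open>threshold_sets\<close> orders the second part by the number of common
  neighbours with a fixed pair. The empty set serves vertices of low degree.\<close>

definition codegree_sets :: "'b set \<Rightarrow> ('a \<times> 'b) set \<Rightarrow> 'a set set" where
  "codegree_sets B R = insert {} ((\<lambda>(y, z). nbrs R y \<inter> nbrs R z) ` (B \<times> B))"

definition threshold_sets :: "'b set \<Rightarrow> ('a \<times> 'b) set \<Rightarrow> 'b set set" where
  "threshold_sets B R =
     insert {} ((\<lambda>(y, z, s). {b\<in>B. s \<le> card (nbrs R b \<inter> nbrs R y \<inter> nbrs R z)}) ` (B \<times> B \<times> UNIV))"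

text \<open>The constant is what \<open>removable_near_or_outside\<close> needs: 3 missing neighbours, 3 for
  each of the two private neighbourhoods, and 12 from \<open>low_degree_vertex\<close> with codegree 6.\<close>

definition close_to :: "'a set set \<Rightarrow> 'a set \<Rightarrow> bool" where
  "close_to T S \<longleftrightarrow> (\<exists>T0\<in>T. card (sym_diff S T0) \<le> 21)"

context P7_C4_K2_free
begin

definition removable :: bool where
  "removable \<longleftrightarrow>
     (\<exists>b\<in>B. close_to (codegree_sets (B - {b}) (R \<inter> A \<times> (B - {b}))) (nbrs R b)) \<or>
     (\<exists>a\<in>A. close_to (threshold_sets B (R \<inter> (A - {a}) \<times> B)) (R `` {a}))"

lemma removable_codegree:
  assumes "b \<in> B" "y \<in> B" "z \<in> B" "y \<noteq> b" "z \<noteq> b"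
    and "sym_diff (nbrs R b) (nbrs R y \<inter> nbrs R z) \<subseteq> E" "card E \<le> 21" "finite E"
  shows removable
proof -
  let ?R = "R \<inter> A \<times> (B - {b})"
  have eq: "nbrs ?R y = nbrs R y" "nbrs ?R z = nbrs R z"
    using assms sub by auto
  have "nbrs R y \<inter> nbrs R z \<in> codegree_sets (B - {b}) ?R"
    using assms eq by (auto simp: codegree_sets_def intro!: image_eqI[of _ _ "(y, z)"])
  moreover have "card (sym_diff (nbrs R b) (nbrs R y \<inter> nbrs R z)) \<le> 21"
    using card_mono[OF assms(8,6)] assms(7) by linarith
  ultimately show ?thesis
    using assms(1) unfolding removable_def close_to_def by blast
qed

lemma removable_low_degree_B:
  assumes "b \<in> B" "card (nbrs R b) \<le> 21"
  shows removable
  unfolding removable_def close_to_def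
  using assms by (intro disjI1 bexI[of _ b] bexI[of _ "{}"]) (auto simp: codegree_sets_def)

lemma removable_low_degree_A:
  assumes "a \<in> A" "card (R `` {a}) \<le> 21"
  shows removable
  unfolding removable_def close_to_def
  using assms by (intro disjI2 bexI[of _ a] bexI[of _ "{}"]) (auto simp: threshold_sets_def)

lemma removable_threshold:
  assumes "a \<in> A" "y \<in> B" "z \<in> B" "a \<notin> nbrs R y \<inter> nbrs R z"
    and "sym_diff (R `` {a}) {b\<in>B. s \<le> card (nbrs R b \<inter> nbrs R y \<inter> nbrs R z)} \<subseteq> E" "card E \<le> 21" "finite E"
  shows removable
proof -
  let ?R = "R \<inter> (A - {a}) \<times> B"
  have eq: "nbrs ?R b \<inter> nbrs ?R y \<inter> nbrs ?R z = nbrs R b \<inter> nbrs R y \<inter> nbrs R z" for b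
    using assms(2-4) sub by auto
  let ?T = "{b\<in>B. s \<le> card (nbrs R b \<inter> nbrs R y \<inter> nbrs R z)}"
  have "?T \<in> threshold_sets B ?R"
    using assms(2,3) eq unfolding threshold_sets_def
    by (intro insertI2 image_eqI[of _ _ "(y, z, s)"]) auto
  moreover have "card (sym_diff (R `` {a}) ?T) \<le> 21"
    using card_mono[OF assms(7,5)] assms(6) by linarith
  ultimately show ?thesis
    using assms(1) unfolding removable_def close_to_def by blast
qed

lemma no_P7_converse_restrict: "\<not> has_P7 ((R \<inter> S \<times> T)\<inverse>)"
proof -
  have "(R \<inter> S \<times> T)\<inverse> = R\<inverse> \<inter> T \<times> S" by auto
  then show ?thesis using has_P7_restrict P7' by metis
qed

end

section \<open>A pair of largest codegree\<close>

text \<open>Fix \<open>y\<close>, \<open>z\<close> in \<open>B\<close> with the largest number of common neighbours, and let \<open>X\<close> be their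
  set. Each pair in \<open>X\<close> spans a \<open>C\<^sub>4\<close> with \<open>y\<close> and \<open>z\<close>, and no codegree exceeds \<open>card X\<close>.\<close>

locale heavy_pair = P7_C4_K2_free +
  fixes y z :: 'b and X :: "'a set"
  assumes yB: "y \<in> B" and zB: "z \<in> B" and yz: "y \<noteq> z"
    and X_def: "X = nbrs R y \<inter> nbrs R z"
    and heavy: "\<And>b b'. b \<in> B \<Longrightarrow> b' \<in> B \<Longrightarrow> b \<noteq> b' \<Longrightarrow> card (nbrs R b \<inter> nbrs R b') \<le> card X"
begin

text \<open>A vertex that misses at most three elements of \<open>X\<close> has few neighbours elsewhere in
  \<open>nbrs R y \<union> nbrs R z\<close>, by the choice of the pair. The others are \<open>far\<close>. Three is what makes two members of the
  cluster in \<open>wild_cluster\<close> have a common non-neighbour in \<open>X\<close>.\<close>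

definition far :: "'b set" where
  "far = {b\<in>B. 3 < card (X - nbrs R b)}"

definition trace :: "'a \<Rightarrow> 'b set" where
  "trace a = {b\<in>far. (a, b) \<in> R}"

definition level :: "'b \<Rightarrow> nat" where
  "level b = card (nbrs R b \<inter> X)"

text \<open>Far vertices are ordered by their \<open>level\<close>; the neighbours of a tame vertex
  form an upper set of this order, up to two exceptions. With this bound the cluster in
  \<open>wild_cluster\<close> has the three members that \<open>twins_in_cluster\<close> needs.\<close>

definition tame :: "'a \<Rightarrow> bool" where
  "tame a \<longleftrightarrow> (\<exists>s. card (sym_diff (trace a) {b\<in>far. s \<le> level b}) \<le> 2)"

text \<open>The neighbours of \<open>y\<close> alone and those of \<open>z\<close> alone play symmetric roles, while \<open>far\<close>,
  \<open>trace\<close>, \<open>level\<close> and \<open>tame\<close> depend on the pair only through \<open>X\<close>.\<close>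

lemma swap: "heavy_pair A B R z y X"
  by unfold_locales (use yB zB yz X_def heavy in auto)

lemma finX [simp]: "finite X"
  by (simp add: X_def)

lemma X_adj: "x \<in> X \<Longrightarrow> (x, y) \<in> R" "x \<in> X \<Longrightarrow> (x, z) \<in> R"
  by (auto simp: X_def)

lemma fin_far [simp]: "finite far"
  using finB by (simp add: far_def)

lemma fin_trace [simp]: "finite (trace a)"
  by (simp add: trace_def)

lemma yz_not_far: "y \<notin> far" "z \<notin> far"
proof -
  have "b \<notin> far" if "X \<subseteq> nbrs R b" for b
  proof
    assume "b \<in> far"
    then have "3 < card (X - nbrs R b)" by (simp add: far_def)
    moreover have "X - nbrs R b = {}" using that by blast
    ultimately show False by (metis card.empty not_less_zero)
  qed
  then show "y \<notin> far" "z \<notin> far" by (auto simp: X_def)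
qed

text \<open>Two exceptions \<open>x\<close>, \<open>x'\<close> would form a \<open>C\<^sub>4\<close> with \<open>b'\<close> and \<open>z\<close>, from which the edge
  \<open>a b\<close> is disjoint and without connecting edges.\<close>

lemma nbrs_nested_up_to_one:
  assumes "(a, z) \<notin> R" "(a, b) \<in> R" "(a, b') \<notin> R" "b' \<in> far"
  shows "card (nbrs R b' \<inter> X - nbrs R b) \<le> 1"
proof (rule ccontr)
  assume "\<not> ?thesis"
  then have "2 \<le> card (nbrs R b' \<inter> X - nbrs R b)" by simp
  then obtain x x' where "x \<in> nbrs R b' \<inter> X - nbrs R b" "x' \<in> nbrs R b' \<inter> X - nbrs R b" "x \<noteq> x'"
    by (rule two_elements)
  then show False
    using no_C4_K2[of x x' b' z a b] assms X_adj yz_not_far by auto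
qed

text \<open>Otherwise the \<open>C\<^sub>4\<close> on \<open>a\<close>, \<open>a'\<close>, \<open>b\<close>, \<open>b'\<close> and the edge \<open>x z\<close>, for an
  uncovered \<open>x\<close>, form an induced \<open>C\<^sub>4 + K\<^sub>2\<close>.\<close>

lemma common_trace_covers:
  assumes "a \<in> nbrs R y - nbrs R z" "a' \<in> nbrs R y - nbrs R z" "a \<noteq> a'"
    "b \<in> trace a" "b \<in> trace a'" "b' \<in> trace a" "b' \<in> trace a'" "b \<noteq> b'"
  shows "X \<subseteq> nbrs R b \<union> nbrs R b'"
proof (rule ccontr)
  assume "\<not> ?thesis"
  then obtain x where "x \<in> X" "x \<notin> nbrs R b" "x \<notin> nbrs R b'" by blast
  then show False
    using no_C4_K2[of a a' b b' x z] assms X_adj by (auto simp: trace_def)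
qed

lemma common_non_nbr:
  assumes "b \<in> far" "card (nbrs R b' \<inter> X - nbrs R b) \<le> 3"
  obtains x where "x \<in> X" "(x, b) \<notin> R" "(x, b') \<notin> R"
proof -
  have "\<not> X - nbrs R b \<subseteq> nbrs R b' \<inter> X - nbrs R b"
  proof
    assume "X - nbrs R b \<subseteq> nbrs R b' \<inter> X - nbrs R b"
    then have "card (X - nbrs R b) \<le> card (nbrs R b' \<inter> X - nbrs R b)" by (intro card_mono) auto
    then show False using assms by (auto simp: far_def)
  qed
  then obtain x where "x \<in> X - nbrs R b" "x \<notin> nbrs R b' \<inter> X - nbrs R b" by blast
  then show thesis using that[of x] by simp
qed

text \<open>For incomparable traces, \<open>b a y x z a' b'\<close> is an induced \<open>P\<^sub>7\<close>, where \<open>x\<close> is a common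
  non-neighbour of \<open>b\<close> and \<open>b'\<close>; it exists since \<open>b\<close> is far and \<open>b'\<close> has at most one further
  neighbour in \<open>X\<close>.\<close>

lemma traces_nested:
  assumes "a \<in> nbrs R y - nbrs R z" "a' \<in> nbrs R z - nbrs R y"
  shows "trace a \<subseteq> trace a' \<or> trace a' \<subseteq> trace a"
proof (rule ccontr)
  assume "\<not> ?thesis"
  then obtain b b' where b: "b \<in> far" "b' \<in> far" "(a, b) \<in> R" "(a', b) \<notin> R" "(a', b') \<in> R" "(a, b') \<notin> R"
    by (auto simp: trace_def)
  have "card (nbrs R b' \<inter> X - nbrs R b) \<le> 1"
    using nbrs_nested_up_to_one[of a b b'] assms b by auto
  then obtain x where "x \<in> X" "(x, b) \<notin> R" "(x, b') \<notin> R"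
    using common_non_nbr[of b b'] b by auto
  then show False
    using no_P7[of a b y x z a' b'] assms b X_adj by auto
qed

text \<open>By \<open>nbrs_nested_up_to_one\<close>, no vertex outside the trace has a level more than one above
  the least level \<open>t\<close> in the trace. So the trace differs from \<open>level \<ge> t\<close> only by vertices \<open>Q\<close>
  outside it, and from \<open>level \<ge> t + 2\<close> only by its members \<open>P\<close> of level \<open>t\<close> or \<open>t + 1\<close>. If
  \<open>a\<close> is not tame, both sets have at least three elements. Each \<open>q\<close> in \<open>Q\<close> has nearly the same
  neighbours in \<open>X\<close> as each \<open>p\<close> in \<open>P\<close>, hence any two elements of \<open>P\<close> are close as well.\<close>

lemma wild_cluster:
  assumes a: "a \<in> nbrs R y - nbrs R z" and wild: "\<not> tame a"
  obtains P where "P \<subseteq> trace a" "3 \<le> card P"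
    "\<And>p p'. p \<in> P \<Longrightarrow> p' \<in> P \<Longrightarrow> card (nbrs R p \<inter> X - nbrs R p') \<le> 3"
proof -
  have wild': "\<And>s. 2 < card (sym_diff (trace a) {b\<in>far. s \<le> level b})"
    using wild by (auto simp: tame_def not_le)
  have level_le: "level b \<le> card X" for b
    unfolding level_def by (rule card_mono) auto
  \<comment> \<open>a threshold above every level shows that the trace is not empty\<close>
  have top: "{b\<in>far. Suc (card X) \<le> level b} = {}" using level_le by (auto simp: not_less_eq_eq)
  have "trace a \<noteq> {}"
  proof
    assume "trace a = {}"
    then show False using wild'[of "Suc (card X)"] unfolding top by simp
  qed
  then obtain b0 where b0: "b0 \<in> trace a" and least: "\<And>b. b \<in> trace a \<Longrightarrow> level b0 \<le> level b"
    using arg_min_if_finite[OF fin_trace, of a level] by (metis not_le)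
  define P where "P = {b\<in>trace a. level b \<le> Suc (level b0)}"
  define Q where "Q = {b\<in>far - trace a. level b0 \<le> level b}"
  have diff: "card (nbrs R q \<inter> X - nbrs R p) \<le> 1" if "p \<in> trace a" "q \<in> far - trace a" for p q
    using nbrs_nested_up_to_one[of a p q] a that by (auto simp: trace_def)
  have bal: "level q + card (nbrs R p \<inter> X - nbrs R q) = level p + card (nbrs R q \<inter> X - nbrs R p)" for p q
  proof -
    have "level p = card (nbrs R p \<inter> nbrs R q \<inter> X) + card (nbrs R p \<inter> X - nbrs R q)" for p q
      unfolding level_def by (subst card_Un_disjoint[symmetric]) (auto intro!: arg_cong[where f=card])
    from this[of p q] this[of q p] show ?thesis by (simp add: Int_commute[of "nbrs R p"])
  qed
  have low: "level q \<le> Suc (level b0)" if "q \<in> far - trace a" for q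
    using bal[of q b0] diff[OF b0 that] by simp
  have "sym_diff (trace a) {b\<in>far. level b0 \<le> level b} = Q"
    using least by (auto simp: Q_def trace_def)
  then have "Q \<noteq> {}" using wild'[of "level b0"] by auto
  then obtain q where q: "q \<in> far - trace a" "level b0 \<le> level q" by (auto simp: Q_def)
  have "sym_diff (trace a) {b\<in>far. level b0 + 2 \<le> level b} = P"
    using low by (fastforce simp: P_def trace_def not_le)
  then have "3 \<le> card P" using wild'[of "level b0 + 2"] by simp
  moreover have "card (nbrs R p \<inter> X - nbrs R p') \<le> 3" if "p \<in> P" "p' \<in> P" for p p'
  proof -
    have "card (nbrs R p \<inter> X - nbrs R q) \<le> 2"
      using bal[of q p] diff[of p q] that q by (auto simp: P_def)
    moreover have "card (nbrs R q \<inter> X - nbrs R p') \<le> 1"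
      using diff[of p' q] that q by (auto simp: P_def)
    moreover have "card (nbrs R p \<inter> X - nbrs R p')
        \<le> card ((nbrs R p \<inter> X - nbrs R q) \<union> (nbrs R q \<inter> X - nbrs R p'))"
      by (intro card_mono) auto
    ultimately show ?thesis
      using card_Un_le[of "nbrs R p \<inter> X - nbrs R q" "nbrs R q \<inter> X - nbrs R p'"] by linarith
  qed
  ultimately show thesis
    by (intro that[of P]) (auto simp: P_def)
qed

text \<open>Members of a cluster are too close to each other to cover \<open>X\<close>, so by
  \<open>common_trace_covers\<close> they have no two common neighbours that are private to \<open>y\<close>.\<close>

lemma cluster_trace_unique:
  assumes "a \<in> nbrs R y - nbrs R z" "a' \<in> nbrs R y - nbrs R z" "a \<noteq> a'"
    and P: "P \<subseteq> trace a" "\<And>p p'. p \<in> P \<Longrightarrow> p' \<in> P \<Longrightarrow> card (nbrs R p \<inter> X - nbrs R p') \<le> 3"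
    and "p \<in> P" "p' \<in> P" "(a', p) \<in> R" "(a', p') \<in> R"
  shows "p = p'"
proof (rule ccontr)
  assume "p \<noteq> p'"
  have far: "p \<in> far" "p' \<in> far" using assms by (auto simp: trace_def)
  then have "X \<subseteq> nbrs R p \<union> nbrs R p'"
    using common_trace_covers[of a a' p p'] assms \<open>p \<noteq> p'\<close> by (auto simp: trace_def)
  moreover obtain x where "x \<in> X" "(x, p) \<notin> R" "(x, p') \<notin> R"
    using common_non_nbr[OF far(1) P(2)] assms by blast
  ultimately show False by auto
qed

text \<open>In the cluster \<open>P\<close> of \<open>a\<close>, suppose that two members \<open>p\<close>, \<open>p'\<close> have further neighbours
  \<open>c\<close>, \<open>c'\<close> private to \<open>y\<close>. These are wild, so each of them has a cluster of at least three
  vertices, of which \<open>a\<close> and the other one can see only two; this gives \<open>q\<close> and \<open>q'\<close>, and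
  \<open>q c p a p' c' q'\<close> is an induced \<open>P\<^sub>7\<close>. So at most one member of \<open>P\<close> has a
  neighbour private to \<open>y\<close> other than \<open>a\<close>, and at least two members have none. The neighbours private to \<open>z\<close>
  do not separate them: their traces are nested with that of \<open>a\<close> and, by the choice of \<open>a\<close>,
  contain it.\<close>

lemma twins_in_cluster:
  assumes a: "a \<in> nbrs R y - nbrs R z"
    and wild: "\<And>a'. a' \<in> nbrs R y - nbrs R z \<Longrightarrow> \<not> tame a'"
    and least: "\<And>a'. a' \<in> nbrs R z - nbrs R y \<Longrightarrow> card (trace a) \<le> card (trace a')"
  obtains p p' where "p \<in> far" "p' \<in> far" "p \<noteq> p'"
    "card (nbrs R p \<inter> X - nbrs R p') \<le> 3" "card (nbrs R p' \<inter> X - nbrs R p) \<le> 3"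
    "\<And>c. c \<in> (nbrs R y \<union> nbrs R z) - X \<Longrightarrow> (c, p) \<in> R \<longleftrightarrow> (c, p') \<in> R"
proof -
  obtain P where P: "P \<subseteq> trace a" "3 \<le> card P"
    "\<And>p p'. p \<in> P \<Longrightarrow> p' \<in> P \<Longrightarrow> card (nbrs R p \<inter> X - nbrs R p') \<le> 3"
    using wild_cluster[OF a wild[OF a]] by blast
  have Pfar: "p \<in> far" "(a, p) \<in> R" if "p \<in> P" for p
    using that P by (auto simp: trace_def)
  \<comment> \<open>the neighbours private to \<open>y\<close>, other than \<open>a\<close>\<close>
  define Z where "Z p = {c \<in> nbrs R y - nbrs R z - {a}. (c, p) \<in> R}" for p
  have tail: "\<exists>q. (c, q) \<in> R \<and> (a, q) \<notin> R \<and> (c', q) \<notin> R"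
    if c: "c \<in> nbrs R y - nbrs R z" "c' \<in> nbrs R y - nbrs R z" "c \<noteq> a" "c \<noteq> c'" for c c'
  proof -
    obtain P' where P': "P' \<subseteq> trace c" "3 \<le> card P'"
      "\<And>p p'. p \<in> P' \<Longrightarrow> p' \<in> P' \<Longrightarrow> card (nbrs R p \<inter> X - nbrs R p') \<le> 3"
      using wild_cluster[OF c(1) wild[OF c(1)]] by blast
    have one: "\<exists>u. \<forall>q\<in>P'. (d, q) \<in> R \<longrightarrow> q = u" if "d \<in> nbrs R y - nbrs R z" "c \<noteq> d" for d
      using cluster_trace_unique[OF c(1) that P'(1,3)] by metis
    obtain u u' where "\<forall>q\<in>P'. (a, q) \<in> R \<longrightarrow> q = u" "\<forall>q\<in>P'. (c', q) \<in> R \<longrightarrow> q = u'"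
      using one[of a] one[of c'] a c by auto
    moreover obtain q where "q \<in> P'" "q \<noteq> u" "q \<noteq> u'"
      using third_element[OF P'(2)] by metis
    ultimately show ?thesis using P'(1) by (auto simp: trace_def)
  qed
  have Z_unique: "p = p'" if pP: "p \<in> P" "p' \<in> P" and nonempty: "Z p \<noteq> {}" "Z p' \<noteq> {}" for p p'
  proof (rule ccontr)
    assume ne: "p \<noteq> p'"
    obtain c c' where c: "c \<in> nbrs R y - nbrs R z" "c \<noteq> a" "(c, p) \<in> R"
       "c' \<in> nbrs R y - nbrs R z" "c' \<noteq> a" "(c', p') \<in> R"
      using nonempty unfolding Z_def by blast
    have n: "(c, p') \<notin> R" "(c', p) \<notin> R"
      using cluster_trace_unique[OF a _ _ P(1,3)] c pP ne by metis+
    then have "c \<noteq> c'" using c by auto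
    then obtain q q' where "(c, q) \<in> R" "(a, q) \<notin> R" "(c', q) \<notin> R" "(c', q') \<in> R" "(a, q') \<notin> R" "(c, q') \<notin> R"
      using tail[of c c'] tail[of c' c] c by metis
    then show False
      using no_P7[of c q p a p' c' q'] c n Pfar pP by blast
  qed
  obtain u where u: "\<And>p. p \<in> P \<Longrightarrow> p \<noteq> u \<Longrightarrow> Z p = {}"
    using Z_unique by metis
  obtain p where p: "p \<in> P" "p \<noteq> u" using third_element[OF P(2)] by metis
  obtain p' where p': "p' \<in> P" "p' \<noteq> u" "p' \<noteq> p" using third_element[OF P(2)] by metis
  have other: "(c, q) \<in> R" if "c \<in> nbrs R z - nbrs R y" "q \<in> P" for c q
  proof -
    have "trace c \<subseteq> trace a \<Longrightarrow> trace c = trace a"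
      using card_seteq[OF fin_trace] least[OF that(1)] by blast
    then have "trace a \<subseteq> trace c" using traces_nested[OF a that(1)] by auto
    then show ?thesis using that P(1) by (auto simp: trace_def)
  qed
  show thesis
  proof (rule that[of p p'])
    fix c assume c: "c \<in> (nbrs R y \<union> nbrs R z) - X"
    show "(c, p) \<in> R \<longleftrightarrow> (c, p') \<in> R"
    proof (cases "c \<in> nbrs R z - nbrs R y")
      case True
      then show ?thesis using other[OF True p(1)] other[OF True p'(1)] by simp
    next
      case False
      then have cy: "c \<in> nbrs R y - nbrs R z" using c by (auto simp: X_def)
      have "Z p = {}" "Z p' = {}" using u p p' by auto
      moreover have "(c, q) \<in> R \<longleftrightarrow> c = a" if "q \<in> P" "Z q = {}" for q
        using cy that Pfar(2)[OF that(1)] unfolding Z_def by blast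
      ultimately show ?thesis using p p' by simp
    qed
  qed (simp_all add: p p'(1) p'(3)[symmetric] Pfar P(3))
qed

text \<open>The codegree of \<open>b\<close> and \<open>y\<close> is at most \<open>card X\<close>, and all but three elements of \<open>X\<close>
  already count towards it.\<close>

lemma near_private_nbrs_card:
  assumes b: "b \<in> B" "b \<notin> far" "b \<noteq> y"
  shows "card (nbrs R b \<inter> (nbrs R y - nbrs R z)) \<le> 3"
proof -
  have "card X = card (X \<inter> nbrs R b) + card (X - nbrs R b)"
    by (subst card_Un_disjoint[symmetric]) (auto intro!: arg_cong[where f=card])
  moreover have "card (X - nbrs R b) \<le> 3" using b by (auto simp: far_def)
  moreover have "card (X \<inter> nbrs R b) + card (nbrs R b \<inter> (nbrs R y - nbrs R z)) \<le> card X"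
  proof -
    have "card (X \<inter> nbrs R b) + card (nbrs R b \<inter> (nbrs R y - nbrs R z))
        = card ((X \<inter> nbrs R b) \<union> (nbrs R b \<inter> (nbrs R y - nbrs R z)))"
      by (intro card_Un_disjoint[symmetric]) (auto simp: X_def)
    also have "\<dots> \<le> card (nbrs R b \<inter> nbrs R y)"
      by (intro card_mono) (auto simp: X_def)
    also have "\<dots> \<le> card X" using heavy b yB by auto
    finally show ?thesis .
  qed
  ultimately show ?thesis by linarith
qed

text \<open>All but six elements of \<open>X\<close> are common neighbours of \<open>b\<close> and \<open>b'\<close>, which leaves room for
  six more outside \<open>X\<close>.\<close>

lemma near_codegree:
  assumes b: "b \<in> B" "b \<notin> far" and b': "b' \<in> B" "b' \<notin> far" and "b \<noteq> b'"
    and U: "U \<inter> X = {}"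
  shows "card (nbrs R b \<inter> nbrs R b' \<inter> U) \<le> 6"
proof -
  have 1: "card (X - nbrs R b) \<le> 3" "card (X - nbrs R b') \<le> 3" using b b' by (auto simp: far_def)
  have "card X \<le> card ((X \<inter> nbrs R b \<inter> nbrs R b') \<union> ((X - nbrs R b) \<union> (X - nbrs R b')))"
    by (intro card_mono) auto
  also have "\<dots> \<le> card (X \<inter> nbrs R b \<inter> nbrs R b') + (card (X - nbrs R b) + card (X - nbrs R b'))"
    by (intro order_trans[OF card_Un_le] add_left_mono card_Un_le)
  finally have 2: "card X \<le> card (X \<inter> nbrs R b \<inter> nbrs R b') + 6" using 1 by linarith
  have "card (X \<inter> nbrs R b \<inter> nbrs R b') + card (nbrs R b \<inter> nbrs R b' \<inter> U)
      = card ((X \<inter> nbrs R b \<inter> nbrs R b') \<union> (nbrs R b \<inter> nbrs R b' \<inter> U))"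
    using U by (intro card_Un_disjoint[symmetric]) auto
  also have "\<dots> \<le> card (nbrs R b \<inter> nbrs R b')"
    by (intro card_mono) auto
  also have "\<dots> \<le> card X" using heavy b b' \<open>b \<noteq> b'\<close> by auto
  finally show ?thesis using 2 by linarith
qed

text \<open>An edge \<open>a b\<close> would avoid the \<open>C\<^sub>4\<close> formed by \<open>y\<close>, \<open>z\<close> and two non-neighbours of \<open>b\<close>
  in \<open>X\<close>.\<close>

lemma outside_anticomplete_far:
  assumes "a \<notin> nbrs R y" "a \<notin> nbrs R z" "b \<in> far"
  shows "(a, b) \<notin> R"
proof
  assume ab: "(a, b) \<in> R"
  have "2 \<le> card (X - nbrs R b)" using assms(3) by (simp add: far_def)
  then obtain x x' where "x \<in> X - nbrs R b" "x' \<in> X - nbrs R b" "x \<noteq> x'"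
    by (rule two_elements)
  then show False
    using no_C4_K2[of x x' y z a b] ab assms yz X_adj by auto
qed

text \<open>Between \<open>U\<close> and \<open>W\<close> codegrees are at most six, so \<open>low_degree_vertex\<close> applies. A vertex of
  \<open>U\<close> has all its neighbours in \<open>W\<close>, and a vertex of \<open>W\<close> has almost the neighbourhood \<open>X\<close>, apart
  from its neighbours in \<open>U\<close>.\<close>

lemma removable_near_or_outside:
  defines "U \<equiv> A - (nbrs R y \<union> nbrs R z)" and "W \<equiv> B - far - {y, z}"
  assumes ne: "U \<noteq> {} \<or> W \<noteq> {}"
  shows removable
proof -
  let ?R = "R \<inter> U \<times> W"
  have nb: "nbrs ?R b = nbrs R b \<inter> U" if "b \<in> W" for b using that by auto
  have "(\<exists>a\<in>U. card (?R `` {a}) \<le> 1) \<or> (\<exists>b\<in>W. card (nbrs ?R b) \<le> 2 * 6)"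
  proof (rule low_degree_vertex)
    fix b b' assume b: "b \<in> W" "b' \<in> W" "b \<noteq> b'"
    have "nbrs ?R b \<inter> nbrs ?R b' = nbrs R b \<inter> nbrs R b' \<inter> U" using nb b by auto
    then show "card (nbrs ?R b \<inter> nbrs ?R b') \<le> 6"
      using near_codegree[of b b' U] b by (auto simp: U_def W_def X_def)
  qed (use ne finA finB no_P7_converse_restrict in \<open>auto simp: U_def W_def\<close>)
  then show ?thesis
  proof (elim disjE bexE)
    fix a assume a: "a \<in> U" "card (?R `` {a}) \<le> 1"
    have "R `` {a} = ?R `` {a}"
      using a sub outside_anticomplete_far[of a] by (auto simp: U_def W_def)
    then show ?thesis using a by (intro removable_low_degree_A[of a]) (auto simp: U_def)
  next
    fix b assume b: "b \<in> W" "card (nbrs ?R b) \<le> 2 * 6"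
    let ?E = "(X - nbrs R b) \<union> (nbrs R b \<inter> (nbrs R y - nbrs R z)) \<union>
        (nbrs R b \<inter> (nbrs R z - nbrs R y)) \<union> nbrs ?R b"
    have 1: "card (X - nbrs R b) \<le> 3" using b by (auto simp: W_def far_def)
    interpret s: heavy_pair A B R z y X by (rule swap)
    have 2: "card (nbrs R b \<inter> (nbrs R y - nbrs R z)) \<le> 3" "card (nbrs R b \<inter> (nbrs R z - nbrs R y)) \<le> 3"
      using near_private_nbrs_card[of b] s.near_private_nbrs_card[of b] b by (auto simp: W_def)
    show ?thesis
    proof (rule removable_codegree[of b y z ?E])
      show "sym_diff (nbrs R b) (nbrs R y \<inter> nbrs R z) \<subseteq> ?E"
        using b sub by (auto simp: U_def X_def nb)
      have "card ?E \<le> 3 + 3 + 3 + 2 * 6"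
        by (intro order_trans[OF card_Un_le] add_mono 1 2 b)
      then show "card ?E \<le> 21" by simp
    qed (use b yB zB in \<open>auto simp: W_def U_def intro: finite_subset[OF _ finA]\<close>)
  qed
qed

lemma removable_tame:
  assumes a: "a \<in> (nbrs R y \<union> nbrs R z) - X" and tame: "tame a" and B: "B = far \<union> {y, z}"
  shows removable
proof -
  obtain s where s: "card (sym_diff (trace a) {b\<in>far. s \<le> level b}) \<le> 2"
    using tame by (auto simp: tame_def)
  let ?E = "sym_diff (trace a) {b\<in>far. s \<le> level b} \<union> {y, z}"
  have "a \<in> A" "a \<notin> nbrs R y \<inter> nbrs R z" using a nbrs_subset X_def by blast+
  have lev: "level b = card (nbrs R b \<inter> nbrs R y \<inter> nbrs R z)" for b
    by (subst level_def) (simp add: X_def Int_assoc)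
  show ?thesis
  proof (rule removable_threshold[of a y z s ?E])
    show "sym_diff (R `` {a}) {b\<in>B. s \<le> card (nbrs R b \<inter> nbrs R y \<inter> nbrs R z)} \<subseteq> ?E"
      using sub B unfolding lev[symmetric] by (auto simp: trace_def)
    have "card {y, z} \<le> 2" by (simp add: card_insert_if)
    then have "card ?E \<le> 2 + 2"
      by (intro order_trans[OF card_Un_le] add_mono s)
    then show "card ?E \<le> 21" by simp
  qed (use \<open>a \<in> A\<close> \<open>a \<notin> nbrs R y \<inter> nbrs R z\<close> yB zB in simp_all)
qed

lemma removable_wild:
  assumes a: "a \<in> nbrs R y - nbrs R z" and A: "A = nbrs R y \<union> nbrs R z"
    and wild: "\<And>a'. a' \<in> nbrs R y - nbrs R z \<Longrightarrow> \<not> tame a'"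
    and least: "\<And>a'. a' \<in> nbrs R z - nbrs R y \<Longrightarrow> card (trace a) \<le> card (trace a')"
  shows removable
proof -
  obtain p p' where p: "p \<in> far" "p' \<in> far" "p \<noteq> p'"
    "card (nbrs R p \<inter> X - nbrs R p') \<le> 3" "card (nbrs R p' \<inter> X - nbrs R p) \<le> 3"
    "\<And>c. c \<in> (nbrs R y \<union> nbrs R z) - X \<Longrightarrow> (c, p) \<in> R \<longleftrightarrow> (c, p') \<in> R"
    using twins_in_cluster[OF a wild least] by blast
  let ?E = "(nbrs R p \<inter> X - nbrs R p') \<union> (nbrs R p' \<inter> X - nbrs R p)"
  show ?thesis
  proof (rule removable_codegree[of p p' p' ?E])
    show "sym_diff (nbrs R p) (nbrs R p' \<inter> nbrs R p') \<subseteq> ?E"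
    proof
      fix c assume c: "c \<in> sym_diff (nbrs R p) (nbrs R p' \<inter> nbrs R p')"
      then have "c \<in> A" using nbrs_subset by blast
      moreover have "\<not> ((c, p) \<in> R \<longleftrightarrow> (c, p') \<in> R)" using c by auto
      ultimately have "c \<in> X" using p(6)[of c] A by blast
      then show "c \<in> ?E" using c by auto
    qed
    have "card ?E \<le> 3 + 3" by (intro order_trans[OF card_Un_le] add_mono p)
    then show "card ?E \<le> 21" by simp
  qed (use p in \<open>auto simp: far_def\<close>)
qed

text \<open>Once there are no vertices as in \<open>removable_near_or_outside\<close>, either \<open>y\<close> and \<open>z\<close> are twins,
  or some private neighbour of \<open>y\<close> or \<open>z\<close> is tame, or all of them are wild; in the last case
  the one with the smallest trace yields two near twins.\<close>

lemma heavy_pair_removable: removable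
proof (cases "A - (nbrs R y \<union> nbrs R z) \<noteq> {} \<or> B - far - {y, z} \<noteq> {}")
  case True
  then show ?thesis by (rule removable_near_or_outside)
next
  case False
  then have A: "A = nbrs R y \<union> nbrs R z" and B: "B = far \<union> {y, z}"
    using nbrs_subset yB zB by (auto simp: far_def)
  let ?C = "(nbrs R y \<union> nbrs R z) - X"
  show ?thesis
  proof (cases "?C = {}")
    case True
    then have "nbrs R y = nbrs R z" by (auto simp: X_def)
    then show ?thesis using yB zB yz by (intro removable_codegree[of y z z "{}"]) auto
  next
    case C: False
    show ?thesis
    proof (cases "\<exists>a\<in>?C. tame a")
      case True
      then show ?thesis using removable_tame B by blast
    next
      case False
      have "finite ?C" by auto
      from arg_min_if_finite[OF this C, of "\<lambda>a. card (trace a)"]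
      obtain a where a: "a \<in> ?C" "\<And>a'. a' \<in> ?C \<Longrightarrow> card (trace a) \<le> card (trace a')"
        by (metis not_le)
      interpret s: heavy_pair A B R z y X by (rule swap)
      show ?thesis
      proof (cases "a \<in> nbrs R y")
        case True
        show ?thesis
          by (rule removable_wild[of a]) (use a False True A in \<open>auto simp: X_def\<close>)
      next
        case a': False
        show ?thesis
          by (rule s.removable_wild[of a]) (use a False a' A in \<open>auto simp: X_def\<close>)
      qed
    qed
  qed
qed

end

text \<open>If \<open>B\<close> has at most one vertex, the bound on codegrees in \<open>low_degree_vertex\<close> is vacuous.\<close>

lemma (in P7_C4_K2_free) removable_vertex:
  assumes "A \<noteq> {} \<or> B \<noteq> {}"
  shows removable
proof (cases "\<exists>b\<in>B. \<exists>b'\<in>B. b \<noteq> b'")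
  case True
  let ?pairs = "{(b, b'). b \<in> B \<and> b' \<in> B \<and> b \<noteq> b'}"
  let ?codeg = "\<lambda>(b, b'). card (nbrs R b \<inter> nbrs R b')"
  have "finite ?pairs" by (rule finite_subset[of _ "B \<times> B"]) (use finB in auto)
  moreover have "?pairs \<noteq> {}" using True by auto
  ultimately have "Max (?codeg ` ?pairs) \<in> ?codeg ` ?pairs" and fin: "finite (?codeg ` ?pairs)"
    by auto
  then obtain y z where yz: "y \<in> B" "z \<in> B" "y \<noteq> z"
    "Max (?codeg ` ?pairs) = card (nbrs R y \<inter> nbrs R z)" by auto
  have max: "card (nbrs R b \<inter> nbrs R b') \<le> card (nbrs R y \<inter> nbrs R z)"
    if "b \<in> B" "b' \<in> B" "b \<noteq> b'" for b b'
    unfolding yz(4)[symmetric] using that by (intro Max_ge[OF fin] image_eqI[of _ _ "(b, b')"]) auto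
  interpret heavy_pair A B R y z "nbrs R y \<inter> nbrs R z"
    by unfold_locales (use yz max in auto)
  show ?thesis by (rule heavy_pair_removable)
next
  case False
  have "(\<exists>a\<in>A. card (R `` {a}) \<le> 1) \<or> (\<exists>b\<in>B. card (nbrs R b) \<le> 2 * 1)"
    by (rule low_degree_vertex) (use assms finA finB sub P7' False in auto)
  then show ?thesis
    using removable_low_degree_A removable_low_degree_B by fastforce
qed

section \<open>Counting bipartite graphs with fixed parts\<close>

definition free_relations :: "'a set \<Rightarrow> 'b set \<Rightarrow> ('a \<times> 'b) set set" where
  "free_relations A B = {R. P7_C4_K2_free A B R}"

lemma finite_free_relations: "finite A \<Longrightarrow> finite B \<Longrightarrow> finite (free_relations A B)"
  by (rule finite_subset[of _ "Pow (A \<times> B)"])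
     (auto simp: free_relations_def P7_C4_K2_free_def)

lemma free_relations_restrict:
  assumes "R \<in> free_relations A B" "S \<subseteq> A" "T \<subseteq> B"
  shows "R \<inter> S \<times> T \<in> free_relations S T"
proof -
  interpret P7_C4_K2_free A B R using assms(1) by (simp add: free_relations_def)
  have "P7_C4_K2_free S T (R \<inter> S \<times> T)"
    by unfold_locales
      (use finA finB assms(2,3) P7 C4_K2 no_P7_converse_restrict in
        \<open>auto intro: finite_subset dest: has_P7_restrict has_C4_K2_restrict\<close>)
  then show ?thesis by (simp add: free_relations_def)
qed

lemma card_small_subsets:
  assumes "finite A"
  shows "card {E. E \<subseteq> A \<and> card E \<le> k} \<le> (card A + 1) ^ k"
proof (induction k)
  case 0
  have "{E. E \<subseteq> A \<and> card E \<le> 0} = {{}}" using assms by (auto dest: finite_subset)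
  then show ?case by simp
next
  case (Suc k)
  let ?S = "\<lambda>k. {E. E \<subseteq> A \<and> card E \<le> k}"
  have fin: "finite (?S k)" using assms by simp
  have "?S (Suc k) \<subseteq> ?S k \<union> (\<lambda>(x, E). insert x E) ` (A \<times> ?S k)"
  proof
    fix E assume E: "E \<in> ?S (Suc k)"
    show "E \<in> ?S k \<union> (\<lambda>(x, E). insert x E) ` (A \<times> ?S k)"
    proof (cases "E = {}")
      case True then show ?thesis by simp
    next
      case False
      then obtain x where x: "x \<in> E" by auto
      moreover have "finite E" using E assms by (auto dest: finite_subset)
      ultimately have "card (E - {x}) \<le> k" using E card_Suc_Diff1[of E x] by simp
      then show ?thesis
        using x E by (intro UnI2 image_eqI[of _ _ "(x, E - {x})"]) auto
    qed
  qed
  then have "card (?S (Suc k)) \<le> card (?S k \<union> (\<lambda>(x, E). insert x E) ` (A \<times> ?S k))"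
    using fin assms by (intro card_mono) auto
  also have "\<dots> \<le> card (?S k) + card A * card (?S k)"
    using fin assms
    by (intro order_trans[OF card_Un_le] add_left_mono order_trans[OF card_image_le]) (auto simp: card_cartesian_product)
  also have "\<dots> = (card A + 1) * card (?S k)" by simp
  also have "\<dots> \<le> (card A + 1) ^ Suc k" unfolding power_Suc by (intro mult_le_mono2 Suc)
  finally show ?case .
qed

lemma card_close_to:
  assumes "finite A" "finite T" "\<And>T0. T0 \<in> T \<Longrightarrow> T0 \<subseteq> A"
  shows "card {S. S \<subseteq> A \<and> close_to T S} \<le> card T * (card A + 1) ^ 21"
    and "finite {S. S \<subseteq> A \<and> close_to T S}"
proof -
  show "finite {S. S \<subseteq> A \<and> close_to T S}" using assms by simp
  let ?S = "{E. E \<subseteq> A \<and> card E \<le> 21}"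
  have "{S. S \<subseteq> A \<and> close_to T S} \<subseteq> (\<lambda>(T0, E). sym_diff T0 E) ` (T \<times> ?S)"
  proof
    fix S assume "S \<in> {S. S \<subseteq> A \<and> close_to T S}"
    then obtain T0 where T0: "T0 \<in> T" "card (sym_diff S T0) \<le> 21" "S \<subseteq> A" by (auto simp: close_to_def)
    then show "S \<in> (\<lambda>(T0, E). sym_diff T0 E) ` (T \<times> ?S)"
      using assms(3)[of T0] by (intro image_eqI[of _ _ "(T0, sym_diff S T0)"]) auto
  qed
  then have "card {S. S \<subseteq> A \<and> close_to T S} \<le> card ((\<lambda>(T0, E). sym_diff T0 E) ` (T \<times> ?S))"
    using assms by (intro card_mono) auto
  also have "\<dots> \<le> card T * card ?S"
    using assms by (intro order_trans[OF card_image_le]) (auto simp: card_cartesian_product)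
  also have "\<dots> \<le> card T * (card A + 1) ^ 21"
    using card_small_subsets[OF assms(1)] by simp
  finally show "card {S. S \<subseteq> A \<and> close_to T S} \<le> card T * (card A + 1) ^ 21" .
qed

lemma codegree_sets_bounds:
  assumes "finite B" "card B \<le> n"
  shows "finite (codegree_sets B R)" "card (codegree_sets B R) \<le> (n + 1) ^ 3"
proof -
  show "finite (codegree_sets B R)" using assms by (simp add: codegree_sets_def)
  have "card (codegree_sets B R) \<le> Suc (card ((\<lambda>(y, z). nbrs R y \<inter> nbrs R z) ` (B \<times> B)))"
    unfolding codegree_sets_def by (rule card_insert_le_m1) auto
  also have "\<dots> \<le> Suc (card (B \<times> B))"
    using assms by (intro Suc_le_mono[THEN iffD2] card_image_le) auto
  also have "\<dots> = Suc (card B * card B)" by (simp add: card_cartesian_product)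
  also have "\<dots> \<le> Suc (n * n)" using assms by (simp add: mult_le_mono)
  also have "\<dots> \<le> (n + 1) ^ 3" by (simp add: power3_eq_cube algebra_simps)
  finally show "card (codegree_sets B R) \<le> (n + 1) ^ 3" .
qed

lemma threshold_sets_bounds:
  assumes "finite A" "finite B" "R \<subseteq> A \<times> B" "card A \<le> n" "card B \<le> n"
  shows "finite (threshold_sets B R)" "card (threshold_sets B R) \<le> (n + 1) ^ 3"
proof -
  let ?f = "\<lambda>(y, z, s). {b\<in>B. s \<le> card (nbrs R b \<inter> nbrs R y \<inter> nbrs R z)}"
  have sub: "threshold_sets B R \<subseteq> insert {} (?f ` (B \<times> B \<times> {..card A}))"
    \<comment> \<open>thresholds beyond \<open>card A\<close> all give the empty set\<close>
  proof
    fix T assume "T \<in> threshold_sets B R"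
    then consider "T = {}" | y z s where "y \<in> B" "z \<in> B" "T = ?f (y, z, s)"
      by (auto simp: threshold_sets_def)
    then show "T \<in> insert {} (?f ` (B \<times> B \<times> {..card A}))"
    proof cases
      case 2
      show ?thesis
      proof (cases "s \<le> card A")
        case True
        then show ?thesis using 2 by (intro insertI2 image_eqI[of _ _ "(y, z, s)"]) auto
      next
        case False
        have "card (nbrs R b \<inter> nbrs R y \<inter> nbrs R z) \<le> card A" for b
          using assms by (intro card_mono) auto
        then have "T = {}" using 2 False by (auto dest: order_trans)
        then show ?thesis by simp
      qed
    qed simp
  qed
  moreover have fin: "finite (insert {} (?f ` (B \<times> B \<times> {..card A})))" using assms by auto
  ultimately show "finite (threshold_sets B R)" by (rule finite_subset)
  have "card (threshold_sets B R) \<le> card (insert {} (?f ` (B \<times> B \<times> {..card A})))"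
    using sub fin by (intro card_mono)
  also have "\<dots> \<le> Suc (card (?f ` (B \<times> B \<times> {..card A})))"
    by (rule card_insert_le_m1) auto
  also have "\<dots> \<le> Suc (card (B \<times> B \<times> {..card A}))"
    using assms by (intro Suc_le_mono[THEN iffD2] card_image_le) auto
  also have "\<dots> = Suc (card B * (card B * (card A + 1)))"
    by (simp add: card_cartesian_product)
  also have "\<dots> \<le> Suc (n * (n * (n + 1)))" using assms by (intro Suc_le_mono[THEN iffD2] mult_le_mono) auto
  also have "\<dots> \<le> (n + 1) ^ 3" by (simp add: power3_eq_cube algebra_simps)
  finally show "card (threshold_sets B R) \<le> (n + 1) ^ 3" .
qed

lemma card_UN_Sigma_image_le:
  assumes "finite I" "\<And>i. i \<in> I \<Longrightarrow> finite (F i)" "\<And>i x. i \<in> I \<Longrightarrow> x \<in> F i \<Longrightarrow> finite (H i x)"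
    "\<And>i. i \<in> I \<Longrightarrow> card (F i) \<le> m" "\<And>i x. i \<in> I \<Longrightarrow> x \<in> F i \<Longrightarrow> card (H i x) \<le> l"
  shows "card (\<Union>i\<in>I. g i ` Sigma (F i) (H i)) \<le> card I * (m * l)"
proof -
  have "card (g i ` Sigma (F i) (H i)) \<le> m * l" if i: "i \<in> I" for i
  proof -
    have "card (g i ` Sigma (F i) (H i)) \<le> card (Sigma (F i) (H i))"
      using assms i by (intro card_image_le) auto
    also have "\<dots> = (\<Sum>x\<in>F i. card (H i x))" using assms i by (intro card_SigmaI) auto
    also have "\<dots> \<le> card (F i) * l" using assms i by (intro sum_bounded_above[of "F i" _ l, simplified]) auto
    also have "\<dots> \<le> m * l" using assms i by simp
    finally show ?thesis .
  qed
  then have "(\<Sum>i\<in>I. card (g i ` Sigma (F i) (H i))) \<le> card I * (m * l)"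
    by (intro sum_bounded_above[of I _ "m * l", simplified])
  then show ?thesis using card_UN_le[OF assms(1), of "\<lambda>i. g i ` Sigma (F i) (H i)"] by linarith
qed

text \<open>Deleting a removable vertex leaves a relation of the same kind; the relation is recovered
  from this, the vertex (at most \<open>n\<close> choices), the set to which the neighbourhood is close (at most
  \<open>(n + 1) ^ 3\<close> choices) and the at most 21 exceptions (at most \<open>(n + 1) ^ 21\<close> choices). So each
  vertex costs a factor \<open>(n + 1) ^ 25\<close>.\<close>

lemma card_free_relations:
  assumes "finite A" "finite B" "card A + card B = k" "k \<le> n"
  shows "card (free_relations A B) \<le> (n + 1) ^ (25 * k)"
  using assms
proof (induction k arbitrary: A B)
  case 0
  then have "free_relations A B \<subseteq> {{}}"
    by (auto simp: free_relations_def P7_C4_K2_free_def)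
  from card_mono[OF _ this] show ?case by simp
next
  case (Suc k)
  let ?near = "\<lambda>V T. {S. S \<subseteq> V \<and> close_to T S}"
  define FB where "FB = (\<Union>b\<in>B. (\<lambda>(R, S). R \<union> S \<times> {b}) `
     (SIGMA R: free_relations A (B - {b}). ?near A (codegree_sets (B - {b}) R)))"
  define FA where "FA = (\<Union>a\<in>A. (\<lambda>(R, S). R \<union> {a} \<times> S) `
     (SIGMA R: free_relations (A - {a}) B. ?near B (threshold_sets B R)))"
  have free_sub: "R \<subseteq> A' \<times> B'" if "R \<in> free_relations A' B'" for R A' B'
    using that by (simp add: free_relations_def P7_C4_K2_free_def)
  have nA: "card A \<le> n" "card B \<le> n" using Suc.prems by auto
  have codegree_sub: "T0 \<subseteq> A" if "R \<subseteq> A \<times> B'" "T0 \<in> codegree_sets B' R" for T0 R B'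
    using that by (auto simp: codegree_sets_def)
  have threshold_sub: "T0 \<subseteq> B" if "T0 \<in> threshold_sets B R" for T0 R
    using that by (auto simp: threshold_sets_def)
  have pow: "x * (m + 1) ^ 21 \<le> (n + 1) ^ 24" if "x \<le> (n + 1) ^ 3" "m \<le> n" for x m
  proof -
    have "x * (m + 1) ^ 21 \<le> (n + 1) ^ 3 * (n + 1) ^ 21"
      using that by (intro mult_le_mono power_mono) auto
    then show ?thesis by (simp flip: power_add)
  qed
  have "card FB \<le> card B * ((n + 1) ^ (25 * k) * (n + 1) ^ 24)"
    unfolding FB_def
  proof (rule card_UN_Sigma_image_le)
    fix b assume b: "b \<in> B"
    then have "Suc (card (B - {b})) = card B" using Suc.prems by (intro card_Suc_Diff1)
    then show "card (free_relations A (B - {b})) \<le> (n + 1) ^ (25 * k)"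
      using Suc.prems by (intro Suc.IH) auto
    show "finite (free_relations A (B - {b}))" by (intro finite_free_relations finite_Diff Suc.prems)
    fix R assume R: "R \<in> free_relations A (B - {b})"
    have c: "card (B - {b}) \<le> n" "finite (B - {b})"
      using card_Diff1_le[of B b] nA Suc.prems(2) by simp_all
    note cb = codegree_sets_bounds[OF c(2,1), of R]
    have "card (?near A (codegree_sets (B - {b}) R)) \<le> card (codegree_sets (B - {b}) R) * (card A + 1) ^ 21"
      using Suc.prems cb codegree_sub[OF free_sub[OF R]] by (intro card_close_to)
    also have "\<dots> \<le> (n + 1) ^ 24" by (intro pow cb nA)
    finally show "card (?near A (codegree_sets (B - {b}) R)) \<le> (n + 1) ^ 24" .
    show "finite (?near A (codegree_sets (B - {b}) R))" using Suc.prems by simp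
  qed (use Suc.prems in auto)
  moreover have "card FA \<le> card A * ((n + 1) ^ (25 * k) * (n + 1) ^ 24)"
    unfolding FA_def
  proof (rule card_UN_Sigma_image_le)
    fix a assume a: "a \<in> A"
    then have "Suc (card (A - {a})) = card A" using Suc.prems by (intro card_Suc_Diff1)
    then show "card (free_relations (A - {a}) B) \<le> (n + 1) ^ (25 * k)"
      using Suc.prems by (intro Suc.IH) auto
    show "finite (free_relations (A - {a}) B)" by (intro finite_free_relations finite_Diff Suc.prems)
    fix R assume R: "R \<in> free_relations (A - {a}) B"
    have c: "card (A - {a}) \<le> n" "finite (A - {a})"
      using card_Diff1_le[of A a] nA Suc.prems(1) by simp_all
    note cb = threshold_sets_bounds[OF c(2) Suc.prems(2) free_sub[OF R] c(1) nA(2)]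
    have "card (?near B (threshold_sets B R)) \<le> card (threshold_sets B R) * (card B + 1) ^ 21"
      using Suc.prems cb threshold_sub by (intro card_close_to)
    also have "\<dots> \<le> (n + 1) ^ 24" by (intro pow cb nA)
    finally show "card (?near B (threshold_sets B R)) \<le> (n + 1) ^ 24" .
    show "finite (?near B (threshold_sets B R))" using Suc.prems by simp
  qed (use Suc.prems in auto)
  moreover have "free_relations A B \<subseteq> FA \<union> FB"
  proof
    fix R assume R: "R \<in> free_relations A B"
    then interpret P7_C4_K2_free A B R by (simp add: free_relations_def)
    have "removable" by (rule removable_vertex) (use Suc.prems in auto)
    then show "R \<in> FA \<union> FB"
      unfolding removable_def
    proof (elim disjE bexE)
      fix b assume b: "b \<in> B" "close_to (codegree_sets (B - {b}) (R \<inter> A \<times> (B - {b}))) (nbrs R b)"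
      have "R \<inter> A \<times> (B - {b}) \<in> free_relations A (B - {b})"
        by (rule free_relations_restrict[OF R]) auto
      moreover have "R = R \<inter> A \<times> (B - {b}) \<union> nbrs R b \<times> {b}" using sub by auto
      ultimately have "R \<in> FB"
        unfolding FB_def using b nbrs_subset
        by (intro UN_I[of b] image_eqI[of _ _ "(R \<inter> A \<times> (B - {b}), nbrs R b)"]) auto
      then show ?thesis by simp
    next
      fix a assume a: "a \<in> A" "close_to (threshold_sets B (R \<inter> (A - {a}) \<times> B)) (R `` {a})"
      have "R \<inter> (A - {a}) \<times> B \<in> free_relations (A - {a}) B"
        by (rule free_relations_restrict[OF R]) auto
      moreover have "R = R \<inter> (A - {a}) \<times> B \<union> {a} \<times> R `` {a}" using sub by auto
      ultimately have "R \<in> FA"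
        unfolding FA_def using a sub
        by (intro UN_I[of a] image_eqI[of _ _ "(R \<inter> (A - {a}) \<times> B, R `` {a})"]) auto
      then show ?thesis by simp
    qed
  qed
  moreover have "finite (FA \<union> FB)"
    unfolding FA_def FB_def using Suc.prems
    by (intro finite_UnI finite_UN_I finite_imageI finite_SigmaI finite_free_relations finite_Diff) simp_all
  ultimately have "card (free_relations A B) \<le> (card A + card B) * ((n + 1) ^ (25 * k) * (n + 1) ^ 24)"
    using card_mono[of "FA \<union> FB" "free_relations A B"] card_Un_le[of FA FB] by (simp add: distrib_right)
  also have "\<dots> \<le> (n + 1) * ((n + 1) ^ (25 * k) * (n + 1) ^ 24)"
    using Suc.prems by (intro mult_le_mono) auto
  also have "\<dots> = (n + 1) ^ (25 * Suc k)"
    by (simp add: power_add[symmetric] flip: power_Suc)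
  finally show ?case .
qed

section \<open>Induced subgraphs as embeddings\<close>

definition induced_embedding :: "('b \<Rightarrow> 'a) \<Rightarrow> 'b graph \<Rightarrow> 'a graph \<Rightarrow> bool" where
  "induced_embedding g H G \<longleftrightarrow> inj_on g (verts H) \<and> g ` verts H \<subseteq> verts G \<and>
     (\<forall>u\<in>verts H. \<forall>v\<in>verts H. {g u, g v} \<in> edges G \<longleftrightarrow> {u, v} \<in> edges H)"

lemma induced_free_iff: "induced_free H G \<longleftrightarrow> \<not> (\<exists>g. induced_embedding g H G)"
proof -
  have "\<exists>S. S \<subseteq> verts G \<and> isomorphic (induced_subgraph G S) H" if g: "induced_embedding g H G" for g
  proof (intro exI conjI)
    show "g ` verts H \<subseteq> verts G" using g by (simp add: induced_embedding_def)
    have inj: "inj_on g (verts H)" using g by (simp add: induced_embedding_def)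
    show "isomorphic (induced_subgraph G (g ` verts H)) H"
      unfolding isomorphic_def induced_subgraph_def fst_conv snd_conv
    proof (intro exI[of _ "inv_into (verts H) g"] conjI ballI)
      show "bij_betw (inv_into (verts H) g) (g ` verts H) (verts H)"
        using inj by (intro bij_betw_inv_into inj_on_imp_bij_betw)
      fix u v assume "u \<in> g ` verts H" "v \<in> g ` verts H"
      then obtain i j where "i \<in> verts H" "j \<in> verts H" "u = g i" "v = g j" by auto
      then show "{u, v} \<in> {e \<in> edges G. e \<subseteq> g ` verts H} \<longleftrightarrow>
          {inv_into (verts H) g u, inv_into (verts H) g v} \<in> edges H"
        using g inj by (auto simp: induced_embedding_def)
    qed
  qed
  moreover have "\<exists>g. induced_embedding g H G" if S: "S \<subseteq> verts G" "isomorphic (induced_subgraph G S) H" for S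
  proof -
    obtain f where f: "bij_betw f S (verts H)"
      "\<And>u v. u \<in> S \<Longrightarrow> v \<in> S \<Longrightarrow> {u, v} \<in> edges G \<longleftrightarrow> {f u, f v} \<in> edges H"
      using S(2) unfolding isomorphic_def induced_subgraph_def by auto
    have b: "bij_betw (inv_into S f) (verts H) S" using f(1) by (rule bij_betw_inv_into)
    have "induced_embedding (inv_into S f) H G"
      unfolding induced_embedding_def
    proof (intro conjI ballI)
      show "inj_on (inv_into S f) (verts H)" using b by (rule bij_betw_imp_inj_on)
      show "inv_into S f ` verts H \<subseteq> verts G" using b S(1) by (simp add: bij_betw_imp_surj_on)
      fix u v assume uv: "u \<in> verts H" "v \<in> verts H"
      then have "inv_into S f u \<in> S" "inv_into S f v \<in> S" using bij_betwE[OF b] by auto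
      then show "{inv_into S f u, inv_into S f v} \<in> edges G \<longleftrightarrow> {u, v} \<in> edges H"
        using f(2) uv bij_betw_inv_into_right[OF f(1)] by simp
    qed
    then show ?thesis by blast
  qed
  ultimately show ?thesis unfolding induced_free_def by blast
qed

lemma induced_embedding_comp:
  assumes "induced_embedding g H G" "induced_embedding h G G'"
  shows "induced_embedding (h \<circ> g) H G'"
proof -
  have g: "inj_on g (verts H)" "g ` verts H \<subseteq> verts G"
      "\<And>u v. u \<in> verts H \<Longrightarrow> v \<in> verts H \<Longrightarrow> {g u, g v} \<in> edges G \<longleftrightarrow> {u, v} \<in> edges H"
    and h: "inj_on h (verts G)" "h ` verts G \<subseteq> verts G'"
      "\<And>u v. u \<in> verts G \<Longrightarrow> v \<in> verts G \<Longrightarrow> {h u, h v} \<in> edges G' \<longleftrightarrow> {u, v} \<in> edges G"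
    using assms unfolding induced_embedding_def by blast+
  have "inj_on (h \<circ> g) (verts H)"
    by (rule comp_inj_on[OF g(1) inj_on_subset[OF h(1) g(2)]])
  moreover have "(h \<circ> g) ` verts H \<subseteq> verts G'"
    using g(2) h(2) by (auto simp: image_subset_iff)
  moreover have "{(h \<circ> g) u, (h \<circ> g) v} \<in> edges G' \<longleftrightarrow> {u, v} \<in> edges H"
    if "u \<in> verts H" "v \<in> verts H" for u v
    using g(2) g(3)[OF that] h(3)[of "g u" "g v"] that by (simp add: image_subset_iff)
  ultimately show ?thesis unfolding induced_embedding_def by blast
qed

lemma isomorphic_embedding:
  assumes "isomorphic G G'" shows "\<exists>h. induced_embedding h G' G"
proof -
  obtain f where f: "bij_betw f (verts G) (verts G')"
    "\<forall>u\<in>verts G. \<forall>v\<in>verts G. {u, v} \<in> edges G \<longleftrightarrow> {f u, f v} \<in> edges G'"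
    using assms by (auto simp: isomorphic_def)
  let ?h = "inv_into (verts G) f"
  have b: "bij_betw ?h (verts G') (verts G)" using f(1) by (rule bij_betw_inv_into)
  have "induced_embedding ?h G' G"
    unfolding induced_embedding_def
  proof (intro conjI ballI)
    show "inj_on ?h (verts G')" using b by (rule bij_betw_imp_inj_on)
    show "?h ` verts G' \<subseteq> verts G" using b by (simp add: bij_betw_imp_surj_on)
    fix u v assume uv: "u \<in> verts G'" "v \<in> verts G'"
    then have "?h u \<in> verts G" "?h v \<in> verts G" using bij_betwE[OF b] by auto
    then show "{?h u, ?h v} \<in> edges G \<longleftrightarrow> {u, v} \<in> edges G'"
      using f(2) uv bij_betw_inv_into_right[OF f(1)] by simp
  qed
  then show ?thesis by blast
qed

lemma induced_subgraph_embedding: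
  "S \<subseteq> verts G \<Longrightarrow> induced_embedding id (induced_subgraph G S) G"
  by (auto simp: induced_embedding_def induced_subgraph_def)

lemma induced_free_embedding:
  "induced_free H G \<Longrightarrow> induced_embedding h G' G \<Longrightarrow> induced_free H G'"
  unfolding induced_free_iff using induced_embedding_comp by blast

lemma bipartite_embedding:
  assumes "bipartite G" "induced_embedding h G' G" "simple_graph G'"
  shows "bipartite G'"
proof -
  obtain A B where AB: "A \<union> B = verts G" "A \<inter> B = {}" "\<forall>e\<in>edges G. \<exists>a\<in>A. \<exists>b\<in>B. e = {a, b}"
    using assms(1) unfolding bipartite_def by (elim exE conjE)
  define A' where "A' = {v\<in>verts G'. h v \<in> A}"
  define B' where "B' = {v\<in>verts G'. h v \<in> B}"
  have edge: "\<exists>a\<in>A'. \<exists>b\<in>B'. e = {a, b}" if e: "e \<in> edges G'" for e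
  proof -
    obtain u v where uv: "e = {u, v}" "u \<in> verts G'" "v \<in> verts G'"
      using assms(3) e by (auto simp: simple_graph_def card_2_iff)
    then have "{h u, h v} \<in> edges G" using assms(2) e unfolding induced_embedding_def by blast
    then obtain a b where "a \<in> A" "b \<in> B" "{h u, h v} = {a, b}" using bspec[OF AB(3)] by blast
    then have "(u \<in> A' \<and> v \<in> B') \<or> (v \<in> A' \<and> u \<in> B')"
      using uv(2,3) unfolding A'_def B'_def doubleton_eq_iff by blast
    then show ?thesis unfolding uv(1) by (metis insert_commute)
  qed
  have "h v \<in> A \<union> B" if "v \<in> verts G'" for v
    using assms(2) that unfolding AB(1) induced_embedding_def by blast
  then have "A' \<union> B' = verts G'" "A' \<inter> B' = {}"
    using AB(2) unfolding A'_def B'_def by blast+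
  then show ?thesis
    unfolding bipartite_def by (intro exI[of _ A'] exI[of _ B'] conjI ballI edge)
qed

lemma simple_induced_subgraph:
  "simple_graph G \<Longrightarrow> S \<subseteq> verts G \<Longrightarrow> simple_graph (induced_subgraph G S)"
  using finite_subset[of S "verts G"] by (simp add: simple_graph_def induced_subgraph_def)

lemma hereditary_bipartite_free:
  "hereditary {G :: nat graph. simple_graph G \<and> bipartite G \<and> induced_free H G \<and> induced_free H' G}"
  (is "hereditary ?X")
proof -
  have closed: "G' \<in> ?X" if "G \<in> ?X" "induced_embedding h G' G" "simple_graph G'" for G G' h
  proof -
    have "bipartite G" "induced_free H G" "induced_free H' G" using that(1) by simp_all
    then have "bipartite G'" "induced_free H G'" "induced_free H' G'"
      using bipartite_embedding[OF _ that(2,3)] induced_free_embedding[OF _ that(2)] by simp_all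
    with that(3) show ?thesis by simp
  qed
  have "G' \<in> ?X" if "G \<in> ?X" "simple_graph G'" "isomorphic G G'" for G G'
    using isomorphic_embedding[OF that(3)] closed[OF that(1) _ that(2)] by blast
  moreover have "induced_subgraph G S \<in> ?X" if "G \<in> ?X" "S \<subseteq> verts G" for G S
    using that by (intro closed[OF that(1) induced_subgraph_embedding] simple_induced_subgraph) simp_all
  ultimately show ?thesis unfolding hereditary_def graph_class_def by blast
qed

section \<open>From graphs to relations\<close>

definition bipartition :: "'a set \<Rightarrow> 'a set \<Rightarrow> 'a graph \<Rightarrow> bool" where
  "bipartition A B G \<longleftrightarrow> A \<union> B = verts G \<and> A \<inter> B = {} \<and> (\<forall>e\<in>edges G. \<exists>a\<in>A. \<exists>b\<in>B. e = {a, b})"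

definition edge_relation :: "'a set \<Rightarrow> 'a set \<Rightarrow> 'a graph \<Rightarrow> ('a \<times> 'a) set" where
  "edge_relation A B G = {(a, b). a \<in> A \<and> b \<in> B \<and> {a, b} \<in> edges G}"

lemma bipartition_swap: "bipartition A B G \<Longrightarrow> bipartition B A G"
  unfolding bipartition_def by (simp add: Un_commute Int_commute) (metis insert_commute)

lemma edge_relation_swap: "edge_relation B A G = (edge_relation A B G)\<inverse>"
  by (auto simp: edge_relation_def insert_commute)

lemma bipartition_edge_iff:
  assumes "bipartition A B G"
  shows "a \<in> A \<Longrightarrow> b \<in> B \<Longrightarrow> {a, b} \<in> edges G \<longleftrightarrow> (a, b) \<in> edge_relation A B G"
    and "a \<in> A \<Longrightarrow> b \<in> B \<Longrightarrow> {b, a} \<in> edges G \<longleftrightarrow> (a, b) \<in> edge_relation A B G"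
    and "a \<in> A \<Longrightarrow> a' \<in> A \<Longrightarrow> {a, a'} \<notin> edges G"
    and "b \<in> B \<Longrightarrow> b' \<in> B \<Longrightarrow> {b, b'} \<notin> edges G"
    and "a \<in> A \<Longrightarrow> {a} \<notin> edges G" and "b \<in> B \<Longrightarrow> {b} \<notin> edges G"
proof -
  show "a \<in> A \<Longrightarrow> b \<in> B \<Longrightarrow> {a, b} \<in> edges G \<longleftrightarrow> (a, b) \<in> edge_relation A B G"
    "a \<in> A \<Longrightarrow> b \<in> B \<Longrightarrow> {b, a} \<in> edges G \<longleftrightarrow> (a, b) \<in> edge_relation A B G"
    by (auto simp: edge_relation_def insert_commute)
  have disj: "A \<inter> B = {}" and ends: "\<And>e. e \<in> edges G \<Longrightarrow> \<exists>a\<in>A. \<exists>b\<in>B. e = {a, b}"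
    using assms by (auto simp: bipartition_def)
  show AA: "a \<in> A \<Longrightarrow> a' \<in> A \<Longrightarrow> {a, a'} \<notin> edges G"
    and BB: "b \<in> B \<Longrightarrow> b' \<in> B \<Longrightarrow> {b, b'} \<notin> edges G" for a a' b b'
    using disj by (auto dest!: ends simp: doubleton_eq_iff)
  show "a \<in> A \<Longrightarrow> {a} \<notin> edges G" "b \<in> B \<Longrightarrow> {b} \<notin> edges G"
    using AA[of a a] BB[of b b] by simp_all
qed

lemma path_graph_edge_iff:
  "{i, j} \<in> edges (path_graph k) \<longleftrightarrow> (j = Suc i \<and> j < k) \<or> (i = Suc j \<and> i < k)"
proof -
  have "{i, j} \<in> edges (path_graph k) \<longleftrightarrow> (\<exists>m. {i, j} = {m, Suc m} \<and> Suc m < k)"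
    by (simp add: path_graph_def)
  also have "\<dots> \<longleftrightarrow> (\<exists>m. (i = m \<and> j = Suc m \<or> i = Suc m \<and> j = m) \<and> Suc m < k)"
    by (simp only: doubleton_eq_iff)
  also have "\<dots> \<longleftrightarrow> (j = Suc i \<and> j < k) \<or> (i = Suc j \<and> i < k)"
    by metis
  finally show ?thesis .
qed

lemma cycle_graph_edge_iff:
  "{i, j} \<in> edges (cycle_graph k) \<longleftrightarrow> (i < k \<and> j = Suc i mod k) \<or> (j < k \<and> i = Suc j mod k)"
proof -
  have "{i, j} \<in> edges (cycle_graph k) \<longleftrightarrow> (\<exists>m. {i, j} = {m, Suc m mod k} \<and> m < k)"
    by (simp add: cycle_graph_def)
  also have "\<dots> \<longleftrightarrow> (\<exists>m. (i = m \<and> j = Suc m mod k \<or> i = Suc m mod k \<and> j = m) \<and> m < k)"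
    by (simp only: doubleton_eq_iff)
  also have "\<dots> \<longleftrightarrow> (i < k \<and> j = Suc i mod k) \<or> (j < k \<and> i = Suc j mod k)"
    by metis
  finally show ?thesis .
qed

lemma complete_graph_edge_iff:
  "{i, j} \<in> edges (complete_graph k) \<longleftrightarrow> i < k \<and> j < k \<and> i \<noteq> j"
proof -
  have "{i, j} \<in> edges (complete_graph k) \<longleftrightarrow> (\<exists>m l. {i, j} = {m, l} \<and> m < k \<and> l < k \<and> m \<noteq> l)"
    by (simp add: complete_graph_def)
  also have "\<dots> \<longleftrightarrow> (\<exists>m l. (i = m \<and> j = l \<or> i = l \<and> j = m) \<and> m < k \<and> l < k \<and> m \<noteq> l)"
    by (simp only: doubleton_eq_iff)
  also have "\<dots> \<longleftrightarrow> i < k \<and> j < k \<and> i \<noteq> j"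
    by metis
  finally show ?thesis .
qed

lemma disjoint_union_edge_iff:
  "{Inl i, Inl j} \<in> edges (disjoint_union G H) \<longleftrightarrow> {i, j} \<in> edges G"
  "{Inr k, Inr l} \<in> edges (disjoint_union G H) \<longleftrightarrow> {k, l} \<in> edges H"
  "{Inl i, Inr l} \<notin> edges (disjoint_union G H)"
  "{Inr l, Inl i} \<notin> edges (disjoint_union G H)"
proof -
  have E: "e \<in> edges (disjoint_union G H) \<longleftrightarrow>
      (\<exists>d\<in>edges G. e = Inl ` d) \<or> (\<exists>d\<in>edges H. e = Inr ` d)" for e
    by (auto simp: disjoint_union_def)
  have "Inl ` {i, j} = Inl ` d \<longleftrightarrow> {i, j} = d" and "Inr ` {k, l} = Inr ` d' \<longleftrightarrow> {k, l} = d'" for d and d'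
    by (rule inj_image_eq_iff, simp)+
  then have l: "{Inl i, Inl j} = Inl ` d \<longleftrightarrow> {i, j} = d" and r: "{Inr k, Inr l} = Inr ` d' \<longleftrightarrow> {k, l} = d'" for d and d'
    unfolding image_insert image_empty by blast+
  have x: "{Inl i, v} \<noteq> Inr ` d'" "{v, Inl i} \<noteq> Inr ` d'" "{Inr l, w} \<noteq> Inl ` d" "{w, Inr l} \<noteq> Inl ` d"
     "{Inr k, w} \<noteq> Inl ` d" for d d' v w i k l
    by blast+
  show "{Inl i, Inl j} \<in> edges (disjoint_union G H) \<longleftrightarrow> {i, j} \<in> edges G"
    unfolding E l using x by metis
  show "{Inr k, Inr l} \<in> edges (disjoint_union G H) \<longleftrightarrow> {k, l} \<in> edges H"
    unfolding E r using x by metis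
  show "{Inl i, Inr l} \<notin> edges (disjoint_union G H)" "{Inr l, Inl i} \<notin> edges (disjoint_union G H)"
    unfolding E using x by metis+
qed

lemma P7_induced:
  assumes "bipartition A B G" "has_P7 (edge_relation A B G)"
  shows "\<not> induced_free (path_graph 7) G"
proof -
  let ?R = "edge_relation A B G"
  obtain a1 a2 a3 b1 b2 b3 b4 where h:
    "(a1, b1) \<in> ?R" "(a1, b2) \<in> ?R" "(a2, b2) \<in> ?R" "(a2, b3) \<in> ?R" "(a3, b3) \<in> ?R" "(a3, b4) \<in> ?R"
    "(a1, b3) \<notin> ?R" "(a1, b4) \<notin> ?R" "(a2, b1) \<notin> ?R" "(a2, b4) \<notin> ?R" "(a3, b1) \<notin> ?R" "(a3, b2) \<notin> ?R"
    using assms(2) unfolding has_P7_def by blast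
  have A: "a1 \<in> A" "a2 \<in> A" "a3 \<in> A" and B: "b1 \<in> B" "b2 \<in> B" "b3 \<in> B" "b4 \<in> B"
    using h by (auto simp: edge_relation_def)
  have AB: "A \<inter> B = {}" "A \<union> B = verts G" using assms(1) by (auto simp: bipartition_def)
  let ?g = "(!) [b1, a1, b2, a2, b3, a3, b4]"
  have verts: "verts (path_graph 7) = {0, 1, 2, 3, 4, 5, 6}"
    by (auto simp: path_graph_def)
  have dist: "distinct [b1, a1, b2, a2, b3, a3, b4]"
    using h A B AB(1) by auto
  have "induced_embedding ?g (path_graph 7) G"
    unfolding induced_embedding_def
  proof (intro conjI)
    show "inj_on ?g (verts (path_graph 7))"
      using dist by (rule inj_on_nth) (simp add: path_graph_def)
    show "?g ` verts (path_graph 7) \<subseteq> verts G"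
      unfolding verts using A B AB(2) by auto
    show "\<forall>u\<in>verts (path_graph 7). \<forall>v\<in>verts (path_graph 7). {?g u, ?g v} \<in> edges G \<longleftrightarrow> {u, v} \<in> edges (path_graph 7)"
      unfolding verts path_graph_edge_iff
      by (simp add: bipartition_edge_iff[OF assms(1)] A B h)
  qed
  then show ?thesis by (auto simp: induced_free_iff)
qed

lemma C4_K2_induced:
  assumes "bipartition A B G" "has_C4_K2 (edge_relation A B G)"
  shows "\<not> induced_free (disjoint_union (cycle_graph 4) (complete_graph 2)) G"
proof -
  let ?R = "edge_relation A B G" and ?H = "disjoint_union (cycle_graph 4) (complete_graph 2)"
  obtain a1 a2 a3 b1 b2 b3 where h: "a1 \<noteq> a2" "b1 \<noteq> b2"
    "(a1, b1) \<in> ?R" "(a1, b2) \<in> ?R" "(a2, b1) \<in> ?R" "(a2, b2) \<in> ?R" "(a3, b3) \<in> ?R"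
    "(a1, b3) \<notin> ?R" "(a2, b3) \<notin> ?R" "(a3, b1) \<notin> ?R" "(a3, b2) \<notin> ?R"
    using assms(2) unfolding has_C4_K2_def by blast
  have A: "a1 \<in> A" "a2 \<in> A" "a3 \<in> A" and B: "b1 \<in> B" "b2 \<in> B" "b3 \<in> B"
    using h by (auto simp: edge_relation_def)
  have AB: "A \<inter> B = {}" "A \<union> B = verts G" using assms(1) by (auto simp: bipartition_def)
  let ?g = "case_sum ((!) [a1, b1, a2, b2]) ((!) [a3, b3])"
  have verts: "verts ?H = {Inl 0, Inl 1, Inl 2, Inl 3, Inr 0, Inr 1}"
    by (auto simp: disjoint_union_def cycle_graph_def complete_graph_def Plus_def)
  have loops: "{Inl i} \<in> edges ?H \<longleftrightarrow> i < 4 \<and> i = Suc i mod 4" "{Inr i} \<notin> edges ?H" for i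
    using disjoint_union_edge_iff(1)[of i i "cycle_graph 4" "complete_graph 2"] cycle_graph_edge_iff[of i i 4]
      disjoint_union_edge_iff(2)[of i i "cycle_graph 4" "complete_graph 2"] complete_graph_edge_iff[of i i 2]
    by simp_all
  have "induced_embedding ?g ?H G"
    unfolding induced_embedding_def
  proof (intro conjI)
    show "inj_on ?g (verts ?H)"
      unfolding verts using h A B AB(1) by (auto simp: inj_on_def)
    show "?g ` verts ?H \<subseteq> verts G"
      unfolding verts using A B AB(2) by auto
    show "\<forall>u\<in>verts ?H. \<forall>v\<in>verts ?H. {?g u, ?g v} \<in> edges G \<longleftrightarrow> {u, v} \<in> edges ?H"
      unfolding verts
      by (simp add: disjoint_union_edge_iff cycle_graph_edge_iff complete_graph_edge_iff
          bipartition_edge_iff[OF assms(1)] A B h loops)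
  qed
  then show ?thesis by (auto simp: induced_free_iff)
qed

lemma edge_relation_free:
  assumes "bipartition A B G" "finite A" "finite B" "induced_free (path_graph 7) G"
    "induced_free (disjoint_union (cycle_graph 4) (complete_graph 2)) G"
  shows "edge_relation A B G \<in> free_relations A B"
proof -
  have "P7_C4_K2_free A B (edge_relation A B G)"
  proof unfold_locales
    show "\<not> has_P7 ((edge_relation A B G)\<inverse>)"
      using P7_induced[OF bipartition_swap[OF assms(1)]] assms(4) edge_relation_swap[of B A G] by auto
    show "\<not> has_P7 (edge_relation A B G)" "\<not> has_C4_K2 (edge_relation A B G)"
      using P7_induced[OF assms(1)] C4_K2_induced[OF assms(1)] assms(4,5) by blast+
  qed (use assms(2,3) in \<open>auto simp: edge_relation_def\<close>)
  then show ?thesis by (simp add: free_relations_def)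
qed

lemma edges_of_edge_relation:
  assumes "bipartition A B G"
  shows "(\<lambda>(a, b). {a, b}) ` edge_relation A B G = edges G"
proof -
  have "\<exists>a\<in>A. \<exists>b\<in>B. e = {a, b}" if "e \<in> edges G" for e
    using assms that by (simp add: bipartition_def)
  then show ?thesis by (fastforce simp: edge_relation_def image_iff)
qed

section \<open>The number of labelled graphs\<close>

definition forbidden_pair_class :: "nat graph set" where
  "forbidden_pair_class = {G. simple_graph G \<and> bipartite G \<and> induced_free (path_graph 7) G \<and>
     induced_free (disjoint_union (cycle_graph 4) (complete_graph 2)) G}"

text \<open>A graph of the class is determined by one part of a bipartition (at most \<open>2 ^ n\<close> choices)
  and the relation between the two parts.\<close>

lemma labelled_count_upper: "labelled_count forbidden_pair_class n \<le> 2 ^ n * (n + 1) ^ (25 * n)"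
proof -
  let ?V = "{1..n}"
  let ?U = "\<Union>A\<in>Pow ?V. (\<lambda>R. (?V, (\<lambda>(a, b). {a, b}) ` R)) ` free_relations A (?V - A)"
  have "{G \<in> forbidden_pair_class. verts G = ?V} \<subseteq> ?U"
  proof
    fix G assume G: "G \<in> {G \<in> forbidden_pair_class. verts G = ?V}"
    then obtain A B where AB: "bipartition A B G"
      by (auto simp: forbidden_pair_class_def bipartite_def bipartition_def)
    then have *: "B = ?V - A" "A \<subseteq> ?V" using G by (auto simp: bipartition_def)
    have "edge_relation A B G \<in> free_relations A B"
      using G by (intro edge_relation_free[OF AB]) (auto simp: forbidden_pair_class_def * intro: finite_subset[OF *(2)])
    moreover have "G = (?V, (\<lambda>(a, b). {a, b}) ` edge_relation A B G)"
      using G edges_of_edge_relation[OF AB] by (auto simp: prod_eq_iff)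
    ultimately show "G \<in> ?U" using * by blast
  qed
  moreover have fin: "finite (free_relations A (?V - A))" if "A \<subseteq> ?V" for A
    using that by (intro finite_free_relations) (auto intro: finite_subset)
  then have "finite ?U" by auto
  ultimately have "labelled_count forbidden_pair_class n \<le> card ?U"
    unfolding labelled_count_def by (rule card_mono[rotated])
  also have "\<dots> \<le> (\<Sum>A\<in>Pow ?V. card ((\<lambda>R. (?V, (\<lambda>(a, b). {a, b}) ` R)) ` free_relations A (?V - A)))"
    by (rule card_UN_le) auto
  also have "\<dots> \<le> (\<Sum>A\<in>Pow ?V. (n + 1) ^ (25 * n))"
  proof (rule sum_mono)
    fix A assume "A \<in> Pow ?V"
    then have A: "A \<subseteq> ?V" "finite A" by (auto intro: finite_subset)
    have "card A + card (?V - A) = n"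
      using A card_mono[OF _ A(1)] by (simp add: card_Diff_subset)
    then have "card (free_relations A (?V - A)) \<le> (n + 1) ^ (25 * n)"
      using A by (intro card_free_relations) auto
    then show "card ((\<lambda>R. (?V, (\<lambda>(a, b). {a, b}) ` R)) ` free_relations A (?V - A)) \<le> (n + 1) ^ (25 * n)"
      using card_image_le[OF fin[OF A(1)]] order_trans by blast
  qed
  also have "\<dots> = 2 ^ n * (n + 1) ^ (25 * n)" by (simp add: card_Pow)
  finally show ?thesis .
qed

definition star_forest :: "nat \<Rightarrow> nat \<Rightarrow> (nat \<Rightarrow> nat) \<Rightarrow> nat graph" where
  "star_forest n k f = ({1..n}, (\<lambda>i. {i, f i}) ` {k<..n})"

text \<open>The middle edge \<open>v w\<close> has an endpoint above \<open>k\<close>, a leaf, and there the walk must turn back. Since \<open>P\<^sub>7\<close>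
  and \<open>C\<^sub>4\<close> contain walks with three edges that never turn back, neither is a subgraph of a
  star forest.\<close>

lemma star_forest_no_walk:
  assumes f: "f \<in> {k<..n} \<rightarrow> {1..k}"
    and "{u, v} \<in> edges (star_forest n k f)" "{v, w} \<in> edges (star_forest n k f)" "{w, x} \<in> edges (star_forest n k f)"
  shows "u = w \<or> v = x"
proof -
  have ends: "\<exists>i. k < i \<and> f i \<le> k \<and> (v = i \<and> w = f i \<or> v = f i \<and> w = i)"
    if edge: "{v, w} \<in> edges (star_forest n k f)" for v w
  proof -
    obtain i where "i \<in> {k<..n}" "{v, w} = {i, f i}" using edge unfolding star_forest_def snd_conv by blast
    moreover then have "f i \<in> {1..k}" using f by blast
    ultimately show ?thesis unfolding doubleton_eq_iff by auto
  qed
  have big: "w = f v" if "{v, w} \<in> edges (star_forest n k f)" "k < v" for v w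
    using ends[OF that(1)] that(2) by auto
  have or: "k < v \<or> k < w" if "{v, w} \<in> edges (star_forest n k f)" for v w
    using ends[OF that] by auto
  have sym: "{v, u} \<in> edges (star_forest n k f)" "{w, v} \<in> edges (star_forest n k f)"
    using assms by (simp_all add: insert_commute)
  from or[OF assms(3)] show ?thesis
  proof
    assume "k < v"
    then show ?thesis using big[OF sym(1)] big[OF assms(3)] by simp
  next
    assume "k < w"
    then show ?thesis using big[OF sym(2)] big[OF assms(4)] by simp
  qed
qed

lemma star_forest_in_class:
  assumes f: "f \<in> {k<..n} \<rightarrow> {1..k}" and "k \<le> n"
  shows "star_forest n k f \<in> forbidden_pair_class"
proof -
  have f': "1 \<le> f i" "f i \<le> k" if "k < i" "i \<le> n" for i using f that by auto
  have "simple_graph (star_forest n k f)"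
    unfolding simple_graph_def
  proof (intro conjI ballI)
    fix e assume "e \<in> edges (star_forest n k f)"
    then obtain i where i: "k < i" "i \<le> n" "e = {i, f i}" by (auto simp: star_forest_def)
    then show "e \<subseteq> verts (star_forest n k f)" "card e = 2"
      using f'[OF i(1,2)] \<open>k \<le> n\<close> by (auto simp: star_forest_def)
  qed (simp add: star_forest_def)
  moreover have "bipartite (star_forest n k f)"
    unfolding bipartite_def
  proof (intro exI conjI ballI)
    show "{k<..n} \<union> {1..k} = verts (star_forest n k f)" using \<open>k \<le> n\<close> by (auto simp: star_forest_def)
    fix e assume "e \<in> edges (star_forest n k f)"
    then obtain i where "i \<in> {k<..n}" "e = {i, f i}" by (auto simp: star_forest_def)
    then show "\<exists>a\<in>{k<..n}. \<exists>b\<in>{1..k}. e = {a, b}" using f by blast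
  qed auto
  moreover have "induced_free (path_graph 7) (star_forest n k f)"
    unfolding induced_free_iff
  proof safe
    fix g assume g: "induced_embedding g (path_graph 7) (star_forest n k f)"
    then have "{g i, g (Suc i)} \<in> edges (star_forest n k f)" if "Suc i < 7" for i
      using that by (auto simp: induced_embedding_def path_graph_edge_iff) (simp add: path_graph_def)
    from this[of 0] this[of 1] this[of 2] have "g 0 = g 2 \<or> g 1 = g 3"
      by (intro star_forest_no_walk[OF f]) (simp_all add: eval_nat_numeral)
    moreover have inj: "inj_on g {..<7}" using g by (simp add: induced_embedding_def path_graph_def)
    ultimately show False using inj_onD[OF inj, of 0 2] inj_onD[OF inj, of 1 3] by auto
  qed
  moreover have "induced_free (disjoint_union (cycle_graph 4) (complete_graph 2)) (star_forest n k f)"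
    unfolding induced_free_iff
  proof safe
    fix g assume g: "induced_embedding g (disjoint_union (cycle_graph 4) (complete_graph 2)) (star_forest n k f)"
    have "Inl i \<in> verts (disjoint_union (cycle_graph 4) (complete_graph 2))" if "i < 4" for i
      using that by (auto simp: disjoint_union_def cycle_graph_def)
    then have "{g (Inl i), g (Inl (Suc i))} \<in> edges (star_forest n k f)" if "Suc i < 4" for i
      using that g by (auto simp: induced_embedding_def disjoint_union_edge_iff cycle_graph_edge_iff)
    from this[of 0] this[of 1] this[of 2] have "g (Inl 0) = g (Inl 2) \<or> g (Inl 1) = g (Inl 3)"
      by (intro star_forest_no_walk[OF f]) (simp_all add: eval_nat_numeral)
    moreover have inj: "inj_on g (Inl ` {..<4})" using g
      by (auto simp: induced_embedding_def disjoint_union_def cycle_graph_def Plus_def inj_on_Un)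
    ultimately show False using inj_onD[OF inj, of "Inl 0" "Inl 2"] inj_onD[OF inj, of "Inl 1" "Inl 3"] by auto
  qed
  ultimately show ?thesis by (simp add: forbidden_pair_class_def)
qed

lemma finite_labelled: "finite {G \<in> forbidden_pair_class. verts G = {1..n}}"
proof (rule finite_subset)
  show "{G \<in> forbidden_pair_class. verts G = {1..n}} \<subseteq> {{1..n}} \<times> Pow (Pow {1..n})"
  proof
    fix G assume G: "G \<in> {G \<in> forbidden_pair_class. verts G = {1..n}}"
    then have "\<forall>e\<in>edges G. e \<subseteq> verts G" unfolding forbidden_pair_class_def simple_graph_def by blast
    then have "\<forall>e\<in>edges G. e \<subseteq> {1..n}" using G by simp
    then show "G \<in> {{1..n}} \<times> Pow (Pow {1..n})" using G by (simp add: mem_Times_iff subset_iff)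
  qed
qed simp

lemma labelled_count_lower:
  assumes "k \<le> n" shows "k ^ (n - k) \<le> labelled_count forbidden_pair_class n"
proof -
  let ?F = "{k<..n} \<rightarrow>\<^sub>E {1..k}"
  have "inj_on (star_forest n k) ?F"
  proof (rule inj_onI)
    fix f f' assume f: "f \<in> ?F" "f' \<in> ?F" "star_forest n k f = star_forest n k f'"
    have "f i = f' i" if i: "i \<in> {k<..n}" for i
    proof -
      have "{i, f i} \<in> edges (star_forest n k f')" using i unfolding f(3)[symmetric] by (auto simp: star_forest_def)
      then obtain j where j: "j \<in> {k<..n}" "{i, f i} = {j, f' j}" by (auto simp: star_forest_def)
      moreover have "f' j \<le> k" using f(2) j(1) by (auto dest: PiE_mem)
      ultimately show ?thesis using i by (auto simp: doubleton_eq_iff)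
    qed
    then show "f = f'" using f(1,2) by (intro PiE_ext)
  qed
  then have "card (star_forest n k ` ?F) = card ?F" by (rule card_image)
  also have "\<dots> = k ^ (n - k)" by (simp add: card_PiE)
  finally have "k ^ (n - k) = card (star_forest n k ` ?F)" ..
  also have "\<dots> \<le> labelled_count forbidden_pair_class n"
    unfolding labelled_count_def
    using star_forest_in_class[OF _ assms] by (intro card_mono finite_labelled) (auto simp: star_forest_def PiE_def)
  finally show ?thesis .
qed

text \<open>The lower bound comes from \<open>n div 2\<close> centres, as \<open>n div 2 \<ge> sqrt n\<close> for \<open>n \<ge> 6\<close>; the upper
  bound uses \<open>n + 1 \<le> n\<^sup>2\<close>.\<close>

lemma log_labelled_count_bigtheta: "(\<lambda>n. log 2 (real (labelled_count forbidden_pair_class n))) \<in> \<Theta>(\<lambda>n. real n * log 2 (real n))"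
proof (rule bigthetaI)
  have "log 2 (real (labelled_count forbidden_pair_class n)) \<le> 51 * (real n * log 2 (real n)) \<and>
    1 / 4 * (real n * log 2 (real n)) \<le> log 2 (real (labelled_count forbidden_pair_class n))" if n: "6 \<le> n" for n
  proof
    define c where "c = labelled_count forbidden_pair_class n"
    define L where "L = log 2 (real n)"
    have L: "1 \<le> L" using n by (simp add: L_def)
    have lower: "(n div 2) ^ (n - n div 2) \<le> c" unfolding c_def by (rule labelled_count_lower) simp
    have half: "0 < n div 2" using n by simp
    have c: "0 < c" by (rule ccontr) (use lower half in simp)
    have "log 2 (real c) \<le> log 2 (2 ^ n * (real n + 1) ^ (25 * n))"
    proof -
      have "real c \<le> real (2 ^ n * (n + 1) ^ (25 * n))" unfolding c_def by (rule of_nat_mono[OF labelled_count_upper])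
      then show ?thesis using c by (intro log_mono) (simp_all add: add.commute)
    qed
    also have "\<dots> = real n + 25 * real n * log 2 (real n + 1)"
      by (simp add: log_mult log_nat_power)
    also have "\<dots> \<le> real n * L + 25 * real n * (2 * L)"
    proof (intro add_mono mult_left_mono)
      have "6 * n \<le> n ^ 2" using n by (simp add: power2_eq_square)
      then have "n + 1 \<le> n ^ 2" using n by linarith
      then have "real (n + 1) \<le> real (n ^ 2)" by (rule of_nat_mono)
      then have "log 2 (real n + 1) \<le> log 2 (real n ^ 2)"
        by (intro log_mono) (simp_all add: add.commute)
      also have "\<dots> = 2 * L" using n by (simp add: L_def log_nat_power)
      finally show "log 2 (real n + 1) \<le> 2 * L" .
      show "real n \<le> real n * L" using L by (simp add: mult_le_cancel_left1)
    qed simp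
    also have "\<dots> = 51 * (real n * L)" by simp
    finally show "log 2 (real (labelled_count forbidden_pair_class n)) \<le> 51 * (real n * log 2 (real n))" by (simp add: c_def L_def)
    have sq: "n \<le> (n div 2) ^ 2"
    proof -
      have "3 * (n div 2) \<le> (n div 2) ^ 2" using n by (simp add: power2_eq_square)
      moreover have "n \<le> 3 * (n div 2)" using n by linarith
      ultimately show ?thesis by linarith
    qed
    have "L \<le> log 2 (real (n div 2) ^ 2)"
      unfolding L_def using n sq by (intro log_mono) (simp_all flip: of_nat_power)
    also have "\<dots> = 2 * log 2 (real (n div 2))" using half by (simp add: log_nat_power)
    finally have L2: "L / 2 \<le> log 2 (real (n div 2))" by simp
    have "1 / 4 * (real n * L) = (real n / 2) * (L / 2)" by simp
    also have "\<dots> \<le> real (n - n div 2) * log 2 (real (n div 2))"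
      using L L2 by (intro mult_mono) auto
    also have "\<dots> = log 2 (real ((n div 2) ^ (n - n div 2)))" using half by (simp add: log_nat_power)
    also have "\<dots> \<le> log 2 (real c)" using lower half by (intro log_mono) (simp_all flip: of_nat_power)
    finally show "1 / 4 * (real n * log 2 (real n)) \<le> log 2 (real (labelled_count forbidden_pair_class n))" by (simp add: c_def L_def)
  qed
  then have ev: "eventually (\<lambda>n. log 2 (real (labelled_count forbidden_pair_class n)) \<le> 51 * (real n * log 2 (real n)) \<and>
    1 / 4 * (real n * log 2 (real n)) \<le> log 2 (real (labelled_count forbidden_pair_class n))) sequentially"
    by (intro eventually_sequentiallyI[of 6])
  have pos: "0 \<le> real n * log 2 (real n)" if "6 \<le> n" for n using that by simp
  have evpos: "eventually (\<lambda>n. 0 \<le> real n * log 2 (real n)) sequentially"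
    by (intro eventually_sequentiallyI[of 6] pos)
  show "(\<lambda>n. log 2 (real (labelled_count forbidden_pair_class n))) \<in> O(\<lambda>n. real n * log 2 (real n))"
    by (rule bigoI[of _ 51], use ev evpos in eventually_elim) auto
  show "(\<lambda>n. log 2 (real (labelled_count forbidden_pair_class n))) \<in> \<Omega>(\<lambda>n. real n * log 2 (real n))"
    by (rule landau_omega.bigI[of "1/4"], simp, use ev evpos in eventually_elim) auto
qed

theorem theorem14:
  "factorial_class {G :: nat graph. simple_graph G \<and> bipartite G \<and>
     induced_free (path_graph 7) G \<and>
     induced_free (disjoint_union (cycle_graph 4) (complete_graph 2)) G}"
  unfolding factorial_class_def forbidden_pair_class_def[symmetric]
proof (intro conjI exI)
  show "hereditary forbidden_pair_class" unfolding forbidden_pair_class_def by (rule hereditary_bipartite_free)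
  show "(\<lambda>n. log 2 (real (labelled_count forbidden_pair_class n))) \<in> \<Theta>(\<lambda>n. real n * log 2 (real n))"
    by (rule log_labelled_count_bigtheta)
  show "\<forall>\<^sub>F n in sequentially. real (labelled_count forbidden_pair_class n) = 2 powr (log 2 (real (labelled_count forbidden_pair_class n)))"
  proof (rule eventually_sequentiallyI[of 1])
    fix n :: nat assume n: "1 \<le> n"
    have "1 ^ (n - 1) \<le> labelled_count forbidden_pair_class n" using labelled_count_lower[OF n] .
    then show "real (labelled_count forbidden_pair_class n) = 2 powr (log 2 (real (labelled_count forbidden_pair_class n)))" by simp
  qed
qed

end
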